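(* The conservation laws for the Noether symmetries of the equation $\Delta_{H^1}u+u=0$ are the following; in particular, each of the stated divergences vanishes for every smooth solution $u$ of the equation. 1. For $T=\frac{\partial}{\partial t}$, $R=y\frac{\partial}{\partial x}-x\frac{\partial}{\partial y}$, $\tilde X=\frac{\partial}{\partial x}-2y\frac{\partial}{\partial t}$, $\tilde Y=\frac{\partial}{\partial y}+2x\frac{\partial}{\partial t}$, the conservation laws are respectively $\mathrm{Div}(\tau)=0$, $\mathrm{Div}(\sigma)=0$, $\mathrm{Div}(\chi)=0$, $\mathrm{Div}(\upsilon)=0$, where, with $F(u)=\frac12u^2$, $$\tau_1=-2yu_t^2-u_xu_t,\quad \tau_2=2xu_t^2-u_yu_t,\quad \tau_3=\tfrac12u_x^2+\tfrac12u_y^2-2(x^2+y^2)u_t^2-F(u);$$ $$\sigma_1=-\tfrac12yu_x^2+\tfrac12yu_y^2+2y(x^2+y^2)u_t^2+xu_xu_y-yF(u),$$ $$\sigma_2=-\tfrac12xu_x^2+\tfrac12xu_y^2-2x(x^2+y^2)u_t^2-yu_xu_y+xF(u),$$ $$\sigma_3=-2y^2u_x^2-2x^2u_y^2+4xyu_xu_y-4y(x^2+y^2)u_xu_t+4x(x^2+y^2)u_yu_t;$$ $$\chi_1=-\tfrac12u_x^2+\tfrac12u_y^2+2(x^2+3y^2)u_t^2+2yu_xu_t-2xu_yu_t-F(u),$$ $$\chi_2=-4xyu_t^2-u_xu_y+2xu_xu_t+2yu_yu_t,$$ $$\chi_3=-3yu_x^2-yu_y^2+4y(x^2+y^2)u_t^2+2xu_xu_y-4(x^2+y^2)u_xu_t+2yF(u);$$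 $$\upsilon_1=-4xyu_t^2-u_xu_y-2xu_xu_t-2yu_yu_t,$$ $$\upsilon_2=\tfrac12u_x^2-\tfrac12u_y^2+2(3x^2+y^2)u_t^2+2yu_xu_t-2xu_yu_t-F(u),$$ $$\upsilon_3=xu_x^2+3xu_y^2-4x(x^2+y^2)u_t^2-2yu_xu_y-4(x^2+y^2)u_yu_t-2xF(u).$$ 2. For $W_\beta=\beta(x,y,t)\frac{\partial}{\partial u}$, where $\Delta_{H^1}\beta+\beta=0$, the conservation law is $\mathrm{Div}(W)=0$, where $W=(W_1,W_2,W_3)$ and $$W_1=\beta(u_x+2yu_t)-u(\beta_x+2y\beta_t),\qquad W_2=\beta(u_y-2xu_t)-u(\beta_y-2x\beta_t),$$ $$W_3=\beta[-2xu_y+2yu_x+4(x^2+y^2)u_t]+2u[x\beta_y-y\beta_x-2(x^2+y^2)\beta_t].$$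
   Context: Coordinates on $\mathbb{R}^3$ (the Heisenberg group $H^1$) are $(x^1,x^2,x^3)=(x,y,t)$, and $u=u(x,y,t)$ is a smooth real-valued function. The Kohn-Laplace operator is $$\Delta_{H^1}u=u_{xx}+u_{yy}+4(x^2+y^2)u_{tt}+4y\,u_{xt}-4x\,u_{yt}.$$ The equation $\Delta_{H^1}u+u=0$ is the Euler-Lagrange equation of $$\mathcal{L}=\tfrac12u_x^2+\tfrac12u_y^2+2(x^2+y^2)u_t^2+2y\,u_xu_t-2x\,u_yu_t-\tfrac12u^2.$$ For $A=(A_1,A_2,A_3)$ depending on $x,y,t,u$ and derivatives of $u$, $\mathrm{Div}(A)=D_xA_1+D_yA_2+D_tA_3$ with $D_x,D_y,D_t$ total derivatives. A Lie point symmetry $S=\xi^i\frac{\partial}{\partial x^i}+\eta\frac{\partial}{\partial u}$ of the equation is a Noether symmetry if $S^{(1)}\mathcal{L}+\mathcal{L}D_i\xi^i=D_i\varphi^i$ identically for some $\varphi=(\varphi^1,\varphi^2,\varphi^3)$, where $S^{(1)}=S+(D_i\eta-(D_i\xi^j)u_j)\frac{\partial}{\partial u_i}$; its conservation law (Noether's theorem) is $D_i\big(\xi^i\mathcal{L}+(\eta-\xi^ju_j)\frac{\partial\mathcal{L}}{\partial u_i}-\varphi^i\big)=0$ on solutions of the equation, for such a $\varphi$. *)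

theory Defs
  imports "HOL-Analysis.Analysis" "HOL-Library.Multiset"
begin

definition pd :: "'i \<Rightarrow> (('i \<Rightarrow> real) \<Rightarrow> real) \<Rightarrow> ('i \<Rightarrow> real) \<Rightarrow> real" where
  "pd i f z = deriv (\<lambda>s. f (z(i := s))) (z i)"

primrec Ck :: "nat \<Rightarrow> (('i \<Rightarrow> real) \<Rightarrow> real) \<Rightarrow> bool" where
  "Ck 0 f \<longleftrightarrow> continuous_on UNIV f"
| "Ck (Suc n) f \<longleftrightarrow> continuous_on UNIV f
     \<and> (\<forall>i z. (\<lambda>s. f (z(i := s))) differentiable (at (z i)))
     \<and> (\<forall>i. Ck n (pd i f))"

text \<open>Continuity refers to the product topology. The definition is used for finite index types
  and, on the infinite jet space below, for functions of finitely many coordinates; in both cases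
  it is the usual notion of a \<open>C\<^sup>\<infinity>\<close> function.\<close>

definition smooth :: "(('i \<Rightarrow> real) \<Rightarrow> real) \<Rightarrow> bool" where
  "smooth f \<longleftrightarrow> (\<forall>n. Ck n f)"

definition depends_on :: "'i set \<Rightarrow> (('i \<Rightarrow> real) \<Rightarrow> real) \<Rightarrow> bool" where
  "depends_on C f \<longleftrightarrow> (\<forall>z w. (\<forall>c\<in>C. z c = w c) \<longrightarrow> f z = f w)"

datatype var = vx | vy | vt

lemma UNIV_var: "UNIV = {vx, vy, vt}"
  using var.exhaust by auto

instance var :: finite
  by standard (simp add: UNIV_var)

type_synonym point = "var \<Rightarrow> real"

text \<open>The coordinate \<open>Jet \<alpha>\<close> stands for the derivative of \<open>u\<close> with respect to the variables in the
  multiset \<open>\<alpha>\<close>: \<open>Jet {#}\<close> is \<open>u\<close> itself, \<open>Jet {#vx, vt#}\<close> is \<open>u\<^sub>x\<^sub>t\<close>.\<close>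

datatype coord = Base var | Jet "var multiset"

type_synonym jetpoint = "coord \<Rightarrow> real"
type_synonym dfun = "jetpoint \<Rightarrow> real"

definition differential_function :: "dfun \<Rightarrow> bool" where
  "differential_function F \<longleftrightarrow> smooth F \<and> (\<exists>C. finite C \<and> depends_on C F)"

definition point_function :: "dfun \<Rightarrow> bool" where
  "point_function F \<longleftrightarrow> smooth F \<and> depends_on (insert (Jet {#}) (range Base)) F"

definition base :: "jetpoint \<Rightarrow> point" where
  "base z = (\<lambda>i. z (Base i))"

definition jet :: "(point \<Rightarrow> real) \<Rightarrow> point \<Rightarrow> jetpoint" where
  "jet u p c = (case c of
       Base i \<Rightarrow> p i
     | Jet \<alpha> \<Rightarrow> (pd vx ^^ count \<alpha> vx) ((pd vy ^^ count \<alpha> vy) ((pd vt ^^ count \<alpha> vt) u)) p)"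

text \<open>Total derivative. For a differential function only finitely many terms of the sum over
  \<open>\<alpha>\<close> are nonzero.\<close>

definition D :: "var \<Rightarrow> dfun \<Rightarrow> dfun" where
  "D i F z = pd (Base i) F z
     + (\<Sum>\<alpha> | pd (Jet \<alpha>) F z \<noteq> 0. z (Jet (add_mset i \<alpha>)) * pd (Jet \<alpha>) F z)"

type_synonym vec = "var \<Rightarrow> dfun"

definition Div :: "vec \<Rightarrow> dfun" where
  "Div A z = (\<Sum>i\<in>UNIV. D i (A i) z)"

abbreviation cx :: dfun where "cx z \<equiv> z (Base vx)"
abbreviation cy :: dfun where "cy z \<equiv> z (Base vy)"
abbreviation ct :: dfun where "ct z \<equiv> z (Base vt)"
abbreviation uu :: dfun where "uu z \<equiv> z (Jet {#})"
abbreviation ux :: dfun where "ux z \<equiv> z (Jet {#vx#})"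
abbreviation uy :: dfun where "uy z \<equiv> z (Jet {#vy#})"
abbreviation ut :: dfun where "ut z \<equiv> z (Jet {#vt#})"
abbreviation uxx :: dfun where "uxx z \<equiv> z (Jet {#vx, vx#})"
abbreviation uyy :: dfun where "uyy z \<equiv> z (Jet {#vy, vy#})"
abbreviation utt :: dfun where "utt z \<equiv> z (Jet {#vt, vt#})"
abbreviation uxt :: dfun where "uxt z \<equiv> z (Jet {#vx, vt#})"
abbreviation uyt :: dfun where "uyt z \<equiv> z (Jet {#vy, vt#})"

definition kohn_laplace :: dfun where
  "kohn_laplace z = uxx z + uyy z + 4 * ((cx z)^2 + (cy z)^2) * utt z
     + 4 * cy z * uxt z - 4 * cx z * uyt z"

definition eqn :: dfun where
  "eqn z = kohn_laplace z + uu z"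

definition solution :: "(point \<Rightarrow> real) \<Rightarrow> bool" where
  "solution u \<longleftrightarrow> smooth u \<and> (\<forall>p. eqn (jet u p) = 0)"

definition lagr :: dfun where
  "lagr z = 1/2 * (ux z)^2 + 1/2 * (uy z)^2 + 2 * ((cx z)^2 + (cy z)^2) * (ut z)^2
     + 2 * cy z * ux z * ut z - 2 * cx z * uy z * ut z - 1/2 * (uu z)^2"

text \<open>\<open>VField \<xi> \<eta>\<close> is \<open>\<xi>\<^sup>i \<partial>/\<partial>x\<^sup>i + \<eta> \<partial>/\<partial>u\<close>.\<close>

datatype vfield = VField (xi: "var \<Rightarrow> dfun") (eta: dfun)

definition point_vfield :: "vfield \<Rightarrow> bool" where
  "point_vfield S \<longleftrightarrow> (\<forall>i. point_function (xi S i)) \<and> point_function (eta S)"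

definition vadd :: "vfield \<Rightarrow> vfield \<Rightarrow> vfield" where
  "vadd S S' = VField (\<lambda>i z. xi S i z + xi S' i z) (\<lambda>z. eta S z + eta S' z)"

definition vscale :: "real \<Rightarrow> vfield \<Rightarrow> vfield" where
  "vscale c S = VField (\<lambda>i z. c * xi S i z) (\<lambda>z. c * eta S z)"

text \<open>Coefficients of \<open>\<partial>/\<partial>u\<^sub>i\<close> and \<open>\<partial>/\<partial>u\<^sub>i\<^sub>j\<close> in the prolongations.\<close>

definition eta1 :: "vfield \<Rightarrow> var \<Rightarrow> dfun" where
  "eta1 S i z = D i (eta S) z - (\<Sum>j\<in>UNIV. D i (xi S j) z * z (Jet {#j#}))"

definition eta2 :: "vfield \<Rightarrow> var \<Rightarrow> var \<Rightarrow> dfun" where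
  "eta2 S i j z = D j (eta1 S i) z - (\<Sum>k\<in>UNIV. D j (xi S k) z * z (Jet {#i, k#}))"

definition prolong1 :: "vfield \<Rightarrow> dfun \<Rightarrow> dfun" where
  "prolong1 S F z = (\<Sum>i\<in>UNIV. xi S i z * pd (Base i) F z) + eta S z * pd (Jet {#}) F z
     + (\<Sum>i\<in>UNIV. eta1 S i z * pd (Jet {#i#}) F z)"

text \<open>Each mixed second derivative is a single jet coordinate, hence is counted once.\<close>

definition prolong2 :: "vfield \<Rightarrow> dfun \<Rightarrow> dfun" where
  "prolong2 S F z = prolong1 S F z
     + (\<Sum>(i, j)\<in>{(vx, vx), (vx, vy), (vx, vt), (vy, vy), (vy, vt), (vt, vt)}.
          eta2 S i j z * pd (Jet {#i, j#}) F z)"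

definition lie_point_symmetry :: "vfield \<Rightarrow> bool" where
  "lie_point_symmetry S \<longleftrightarrow> point_vfield S \<and> (\<forall>z. eqn z = 0 \<longrightarrow> prolong2 S eqn z = 0)"

definition noether_gauge :: "vfield \<Rightarrow> vec \<Rightarrow> bool" where
  "noether_gauge S \<phi> \<longleftrightarrow> (\<forall>i. differential_function (\<phi> i))
     \<and> (\<forall>z. prolong1 S lagr z + lagr z * (\<Sum>i\<in>UNIV. D i (xi S i) z) = Div \<phi> z)"

definition noether_symmetry :: "vfield \<Rightarrow> bool" where
  "noether_symmetry S \<longleftrightarrow> lie_point_symmetry S \<and> (\<exists>\<phi>. noether_gauge S \<phi>)"

definition noether_current :: "vfield \<Rightarrow> vec \<Rightarrow> vec" where
  "noether_current S \<phi> i z = xi S i z * lagr z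
     + (eta S z - (\<Sum>j\<in>UNIV. xi S j z * z (Jet {#j#}))) * pd (Jet {#i#}) lagr z - \<phi> i z"

text \<open>\<open>Div A = 0\<close> is the conservation law that Noether's theorem attaches to \<open>S\<close>, for some
  choice of \<open>\<phi>\<close>.\<close>

definition noether_law :: "vfield \<Rightarrow> vec \<Rightarrow> bool" where
  "noether_law S A \<longleftrightarrow> noether_symmetry S \<and> (\<exists>\<phi>. noether_gauge S \<phi> \<and> A = noether_current S \<phi>)"

definition conserved :: "vec \<Rightarrow> bool" where
  "conserved A \<longleftrightarrow> (\<forall>u. solution u \<longrightarrow> (\<forall>p. Div A (jet u p) = 0))"

definition symT :: vfield where
  "symT = VField (\<lambda>i z. case i of vx \<Rightarrow> 0 | vy \<Rightarrow> 0 | vt \<Rightarrow> 1) (\<lambda>z. 0)"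

definition symR :: vfield where
  "symR = VField (\<lambda>i z. case i of vx \<Rightarrow> cy z | vy \<Rightarrow> - cx z | vt \<Rightarrow> 0) (\<lambda>z. 0)"

definition symX :: vfield where
  "symX = VField (\<lambda>i z. case i of vx \<Rightarrow> 1 | vy \<Rightarrow> 0 | vt \<Rightarrow> - 2 * cy z) (\<lambda>z. 0)"

definition symY :: vfield where
  "symY = VField (\<lambda>i z. case i of vx \<Rightarrow> 0 | vy \<Rightarrow> 1 | vt \<Rightarrow> 2 * cx z) (\<lambda>z. 0)"

definition symW :: "(point \<Rightarrow> real) \<Rightarrow> vfield" where
  "symW \<beta> = VField (\<lambda>i z. 0) (\<lambda>z. \<beta> (base z))"

definition Fu :: dfun where
  "Fu z = 1/2 * (uu z)^2"

primrec tau_vec :: vec where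
  "tau_vec vx = (\<lambda>z. - 2 * cy z * (ut z)^2 - ux z * ut z)"
| "tau_vec vy = (\<lambda>z. 2 * cx z * (ut z)^2 - uy z * ut z)"
| "tau_vec vt = (\<lambda>z. 1/2 * (ux z)^2 + 1/2 * (uy z)^2 - 2 * ((cx z)^2 + (cy z)^2) * (ut z)^2 - Fu z)"

primrec sigma_vec :: vec where
  "sigma_vec vx = (\<lambda>z. - 1/2 * cy z * (ux z)^2 + 1/2 * cy z * (uy z)^2
     + 2 * cy z * ((cx z)^2 + (cy z)^2) * (ut z)^2 + cx z * ux z * uy z - cy z * Fu z)"
| "sigma_vec vy = (\<lambda>z. - 1/2 * cx z * (ux z)^2 + 1/2 * cx z * (uy z)^2
     - 2 * cx z * ((cx z)^2 + (cy z)^2) * (ut z)^2 - cy z * ux z * uy z + cx z * Fu z)"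
| "sigma_vec vt = (\<lambda>z. - 2 * (cy z)^2 * (ux z)^2 - 2 * (cx z)^2 * (uy z)^2
     + 4 * cx z * cy z * ux z * uy z
     - 4 * cy z * ((cx z)^2 + (cy z)^2) * ux z * ut z
     + 4 * cx z * ((cx z)^2 + (cy z)^2) * uy z * ut z)"

primrec chi_vec :: vec where
  "chi_vec vx = (\<lambda>z. - 1/2 * (ux z)^2 + 1/2 * (uy z)^2 + 2 * ((cx z)^2 + 3 * (cy z)^2) * (ut z)^2
     + 2 * cy z * ux z * ut z - 2 * cx z * uy z * ut z - Fu z)"
| "chi_vec vy = (\<lambda>z. - 4 * cx z * cy z * (ut z)^2 - ux z * uy z
     + 2 * cx z * ux z * ut z + 2 * cy z * uy z * ut z)"
| "chi_vec vt = (\<lambda>z. - 3 * cy z * (ux z)^2 - cy z * (uy z)^2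
     + 4 * cy z * ((cx z)^2 + (cy z)^2) * (ut z)^2 + 2 * cx z * ux z * uy z
     - 4 * ((cx z)^2 + (cy z)^2) * ux z * ut z + 2 * cy z * Fu z)"

primrec upsilon_vec :: vec where
  "upsilon_vec vx = (\<lambda>z. - 4 * cx z * cy z * (ut z)^2 - ux z * uy z
     - 2 * cx z * ux z * ut z - 2 * cy z * uy z * ut z)"
| "upsilon_vec vy = (\<lambda>z. 1/2 * (ux z)^2 - 1/2 * (uy z)^2 + 2 * (3 * (cx z)^2 + (cy z)^2) * (ut z)^2
     + 2 * cy z * ux z * ut z - 2 * cx z * uy z * ut z - Fu z)"
| "upsilon_vec vt = (\<lambda>z. cx z * (ux z)^2 + 3 * cx z * (uy z)^2
     - 4 * cx z * ((cx z)^2 + (cy z)^2) * (ut z)^2 - 2 * cy z * ux z * uy z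
     - 4 * ((cx z)^2 + (cy z)^2) * uy z * ut z - 2 * cx z * Fu z)"

primrec Wvec :: "(point \<Rightarrow> real) \<Rightarrow> vec" where
  "Wvec \<beta> vx = (\<lambda>z. \<beta> (base z) * (ux z + 2 * cy z * ut z)
     - uu z * (pd vx \<beta> (base z) + 2 * cy z * pd vt \<beta> (base z)))"
| "Wvec \<beta> vy = (\<lambda>z. \<beta> (base z) * (uy z - 2 * cx z * ut z)
     - uu z * (pd vy \<beta> (base z) - 2 * cx z * pd vt \<beta> (base z)))"
| "Wvec \<beta> vt = (\<lambda>z. \<beta> (base z) * (- 2 * cx z * uy z + 2 * cy z * ux z
       + 4 * ((cx z)^2 + (cy z)^2) * ut z)
     + 2 * uu z * (cx z * pd vy \<beta> (base z) - cy z * pd vx \<beta> (base z)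
       - 2 * ((cx z)^2 + (cy z)^2) * pd vt \<beta> (base z)))"

end

theory Submission
  imports Defs "HOL-Computational_Algebra.Polynomial"
begin

text \<open>
  The conservation laws are identities: each current has divergence equal to a multiple of the
  equation, the multiplier being minus the characteristic of the symmetry for the first four
  fields and \<open>\<beta>\<close> for \<open>W\<^sub>\<beta>\<close>, where a multiple of the equation for \<open>\<beta>\<close> is added.

  For the classification, the Lie condition forces \<open>\<xi>\<close> to depend on the base point only and \<open>\<eta>\<close> to
  be \<open>\<alpha> u + \<beta>\<close>. In the frame \<open>X = \<partial>\<^sub>x + 2y \<partial>\<^sub>t\<close>, \<open>Y = \<partial>\<^sub>y - 2x \<partial>\<^sub>t\<close> with \<open>[X, Y] = -4 \<partial>\<^sub>t\<close> the field \<open>\<xi>\<close> is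
  conformal with factor \<open>P\<close>. The commutation relations make \<open>P\<close> and hence \<open>\<alpha>\<close> harmonic for the
  sublaplacian, while the zeroth order term of the equation requires \<open>\<Delta>\<alpha> = - 2 P\<close>. So \<open>P = 0\<close> and
  \<open>\<xi>\<close> is an infinitesimal isometry, which leaves only the field \<open>u \<partial>/\<partial>u\<close> to exclude.
  If it were a Noether symmetry, a multiple of the Lagrangian would be a divergence. The Lagrangian
  differs from a sum of squares by a divergence, and the integral of a divergence over the unit
  cube does not change when a test function vanishing to high order on the boundary is inserted.
\<close>

subsection \<open>Partial derivatives\<close>

text \<open>The differentiability clause of \<open>Ck (Suc n)\<close>, isolated because the sum and
  product rules for \<open>pd\<close> act along one coordinate line at a time and need only
  this.\<close>

definition partially_differentiable :: "(('i \<Rightarrow> real) \<Rightarrow> real) \<Rightarrow> bool" where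
  "partially_differentiable f \<longleftrightarrow> (\<forall>i z. (\<lambda>s. f (z(i := s))) differentiable (at (z i)))"

lemma has_derivative_pd:
  assumes "partially_differentiable f"
  shows "((\<lambda>s. f (z(i := s))) has_real_derivative pd i f (z(i := s))) (at s)"
proof -
  have "(\<lambda>s'. f ((z(i := s))(i := s'))) differentiable (at ((z(i := s)) i))"
    using assms unfolding partially_differentiable_def by blast
  then have "((\<lambda>s'. f ((z(i := s))(i := s'))) has_real_derivative
      deriv (\<lambda>s'. f ((z(i := s))(i := s'))) s) (at s)"
    by (simp add: real_differentiable_def DERIV_deriv_iff_real_differentiable)
  then show ?thesis
    by (simp add: pd_def)
qed

lemma has_derivative_pd_at:
  assumes "partially_differentiable f"
  shows "((\<lambda>s. f (z(i := s))) has_real_derivative pd i f z) (at (z i))"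
  using has_derivative_pd[OF assms, of z i "z i"] by simp

lemma pd_eqI:
  assumes "((\<lambda>s. f (z(i := s))) has_real_derivative d) (at (z i))"
  shows "pd i f z = d"
  using assms by (simp add: pd_def DERIV_imp_deriv)

lemma partially_differentiableI:
  assumes "\<And>i z. \<exists>d. ((\<lambda>s. f (z(i := s))) has_real_derivative d) (at (z i))"
  shows "partially_differentiable f"
  using assms by (simp add: partially_differentiable_def real_differentiable_def)

named_theorems partial_intros

lemma partially_differentiable_const [partial_intros]: "partially_differentiable (\<lambda>z. c)"
  by (auto intro!: partially_differentiableI derivative_eq_intros)

lemma partially_differentiable_coord [partial_intros]: "partially_differentiable (\<lambda>z. z c)"
proof (rule partially_differentiableI)
  fix i and z :: "'a \<Rightarrow> real"
  show "\<exists>d. ((\<lambda>s. (z(i := s)) c) has_real_derivative d) (at (z i))"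
    by (cases "i = c") (auto intro: derivative_eq_intros)
qed

lemma
  assumes f: "partially_differentiable f" and g: "partially_differentiable g"
  shows partially_differentiable_add [partial_intros]: "partially_differentiable (\<lambda>z. f z + g z)"
    and partially_differentiable_diff [partial_intros]: "partially_differentiable (\<lambda>z. f z - g z)"
    and partially_differentiable_mult [partial_intros]: "partially_differentiable (\<lambda>z. f z * g z)"
    and pd_add: "pd i (\<lambda>z. f z + g z) = (\<lambda>z. pd i f z + pd i g z)"
    and pd_diff: "pd i (\<lambda>z. f z - g z) = (\<lambda>z. pd i f z - pd i g z)"
    and pd_mult: "pd i (\<lambda>z. f z * g z) = (\<lambda>z. pd i f z * g z + f z * pd i g z)"
proof -
  note df = has_derivative_pd_at[OF f] and dg = has_derivative_pd_at[OF g]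
  show "partially_differentiable (\<lambda>z. f z + g z)"
    by (rule partially_differentiableI, rule exI, rule DERIV_add[OF df dg])
  show "partially_differentiable (\<lambda>z. f z - g z)"
    by (rule partially_differentiableI, rule exI, rule DERIV_diff[OF df dg])
  show "partially_differentiable (\<lambda>z. f z * g z)"
    by (rule partially_differentiableI, rule exI, rule DERIV_mult[OF df dg])
  show "pd i (\<lambda>z. f z + g z) = (\<lambda>z. pd i f z + pd i g z)"
    by (rule ext, rule pd_eqI, rule DERIV_add[OF df dg])
  show "pd i (\<lambda>z. f z - g z) = (\<lambda>z. pd i f z - pd i g z)"
    by (rule ext, rule pd_eqI, rule DERIV_diff[OF df dg])
  show "pd i (\<lambda>z. f z * g z) = (\<lambda>z. pd i f z * g z + f z * pd i g z)"
  proof (rule ext, rule pd_eqI)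
    fix z
    show "((\<lambda>s. f (z(i := s)) * g (z(i := s))) has_real_derivative
        pd i f z * g z + f z * pd i g z) (at (z i))"
      using DERIV_mult[OF df[of z i] dg[of z i]] by (simp add: algebra_simps)
  qed
qed

lemma pd_const [simp]: "pd i (\<lambda>z. c) = (\<lambda>z. 0)"
  by (rule ext, rule pd_eqI) simp

lemma pd_coord [simp]: "pd i (\<lambda>z. z c) = (\<lambda>z. if i = c then 1 else 0)"
  by (rule ext, rule pd_eqI) (auto intro: derivative_eq_intros)

lemma
  assumes f: "partially_differentiable f"
  shows partially_differentiable_minus [partial_intros]: "partially_differentiable (\<lambda>z. - f z)"
    and partially_differentiable_power2 [partial_intros]: "partially_differentiable (\<lambda>z. (f z)\<^sup>2)"
    and pd_minus: "pd i (\<lambda>z. - f z) = (\<lambda>z. - pd i f z)"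
    and pd_power2: "pd i (\<lambda>z. (f z)\<^sup>2) = (\<lambda>z. 2 * f z * pd i f z)"
proof -
  show "partially_differentiable (\<lambda>z. - f z)" "pd i (\<lambda>z. - f z) = (\<lambda>z. - pd i f z)"
    using partially_differentiable_diff[OF partially_differentiable_const[of 0] f]
      pd_diff[OF partially_differentiable_const[of 0] f] by simp_all
  show "partially_differentiable (\<lambda>z. (f z)\<^sup>2)" "pd i (\<lambda>z. (f z)\<^sup>2) = (\<lambda>z. 2 * f z * pd i f z)"
    using partially_differentiable_mult[OF f f] pd_mult[OF f f]
    by (simp_all add: power2_eq_square algebra_simps)
qed

lemma
  assumes f: "partially_differentiable f"
  shows partially_differentiable_divide [partial_intros]: "partially_differentiable (\<lambda>z. f z / c)"
    and pd_divide: "pd i (\<lambda>z. f z / c) = (\<lambda>z. pd i f z / c)"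
  using partially_differentiable_mult[OF f partially_differentiable_const[of "1 / c"]]
    pd_mult[OF f partially_differentiable_const[of "1 / c"]] by simp_all

lemmas pd_simps = pd_add pd_diff pd_mult pd_minus pd_power2 pd_divide

lemma pd_eq_0_if_depends_on:
  assumes "depends_on C f" "i \<notin> C"
  shows "pd i f = (\<lambda>z. 0)"
proof
  fix z
  have "(\<lambda>s. f (z(i := s))) = (\<lambda>s. f z)"
    using assms unfolding depends_on_def by (auto simp: fun_eq_iff)
  then show "pd i f z = 0"
    by (simp add: pd_def)
qed

lemma depends_on_pd:
  assumes "depends_on C f"
  shows "depends_on C (pd i f)"
proof (cases "i \<in> C")
  case True
  show ?thesis
    unfolding depends_on_def
  proof (intro allI impI)
    fix z w :: "'a \<Rightarrow> real"
    assume *: "\<forall>c\<in>C. z c = w c"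
    have "f (z(i := s)) = f (w(i := s))" for s
      using assms * unfolding depends_on_def by auto
    then show "pd i f z = pd i f w"
      using * True by (simp add: pd_def)
  qed
next
  case False
  then show ?thesis
    using pd_eq_0_if_depends_on[OF assms] by (simp add: depends_on_def)
qed

lemma depends_on_mono: "depends_on C f \<Longrightarrow> C \<subseteq> C' \<Longrightarrow> depends_on C' f"
  unfolding depends_on_def by (metis subsetD)

text \<open>The coordinates in \<open>C\<close> are changed one at a time; each change runs along a
  line on which the derivative is zero. Finiteness of \<open>C\<close> makes this work on the
  infinite jet space as well.\<close>

lemma eq_on_finite_difference_if_pd_eq_0:
  assumes f: "partially_differentiable f" and "finite C"
    and "\<And>i z. i \<in> C \<Longrightarrow> pd i f z = 0" and "\<And>i. i \<notin> C \<Longrightarrow> z i = w i"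
  shows "f z = f w"
  using assms(2-)
proof (induction C arbitrary: w rule: finite_induct)
  case empty
  then have "z = w" by auto
  then show ?case by simp
next
  case (insert c C)
  have "f z = f (w(c := z c))"
    by (rule insert.IH) (use insert.prems in \<open>auto\<close>)
  also have "\<dots> = f (w(c := w c))"
    using DERIV_isconst_all[of "\<lambda>s. f (w(c := s))" "z c" "w c"]
      has_derivative_pd[OF f, of w c] insert.prems(1) by simp
  finally show ?case by simp
qed

subsection \<open>Smooth functions\<close>

lemma Ck_SucD: "Ck (Suc n) f \<Longrightarrow> Ck n f"
  by (induction n arbitrary: f) auto

lemma Ck_Suc_iff:
  "Ck (Suc n) f \<longleftrightarrow> continuous_on UNIV f \<and> partially_differentiable f \<and> (\<forall>i. Ck n (pd i f))"
  by (simp add: partially_differentiable_def)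

text \<open>A one-step unfolding that hides the order \<open>n\<close>: the class is closed under
  \<open>pd\<close>.\<close>

lemma smooth_iff:
  "smooth f \<longleftrightarrow> continuous_on UNIV f \<and> partially_differentiable f \<and> (\<forall>i. smooth (pd i f))"
proof
  assume "smooth f"
  then have "Ck (Suc n) f" for n
    unfolding smooth_def by blast
  then show "continuous_on UNIV f \<and> partially_differentiable f \<and> (\<forall>i. smooth (pd i f))"
    unfolding smooth_def Ck_Suc_iff by blast
next
  assume *: "continuous_on UNIV f \<and> partially_differentiable f \<and> (\<forall>i. smooth (pd i f))"
  have "Ck n f" for n
    using * by (cases n) (auto simp: smooth_def partially_differentiable_def)
  then show "smooth f"
    unfolding smooth_def by blast
qed

lemma smooth_continuous: "smooth f \<Longrightarrow> continuous_on UNIV f"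
  using smooth_iff by blast

lemma smooth_partially_differentiable [partial_intros]:
  "smooth f \<Longrightarrow> partially_differentiable f"
  using smooth_iff by blast

named_theorems smooth_intros

lemma smooth_pd [smooth_intros]: "smooth f \<Longrightarrow> smooth (pd i f)"
  using smooth_iff by blast

lemma Ck_const: "Ck n (\<lambda>z. c)"
  by (induction n arbitrary: c)
    (auto simp: Ck_Suc_iff simp del: Ck.simps(2) intro: partial_intros)

lemma smooth_const [smooth_intros]: "smooth (\<lambda>z. c)"
  by (simp add: smooth_def Ck_const)

lemma smooth_coord [smooth_intros]: "smooth (\<lambda>z. z c)"
proof -
  have "Ck n (\<lambda>z. z c)" for n
    by (cases n) (auto simp: Ck_Suc_iff Ck_const simp del: Ck.simps(2) intro: partial_intros)
  then show ?thesis
    by (simp add: smooth_def)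
qed

lemma Ck_add: "Ck n f \<Longrightarrow> Ck n g \<Longrightarrow> Ck n (\<lambda>z. f z + g z)"
  by (induction n arbitrary: f g)
    (auto simp: Ck_Suc_iff pd_add simp del: Ck.simps(2) intro: partial_intros continuous_on_add
      intro!: continuous_on_add)

lemma Ck_mult: "Ck n f \<Longrightarrow> Ck n g \<Longrightarrow> Ck n (\<lambda>z. f z * g z)"
proof (induction n arbitrary: f g)
  case 0
  then show ?case by (auto intro: continuous_on_mult)
next
  case (Suc n)
  then have "Ck n f" "Ck n g"
    by (blast dest: Ck_SucD)+
  with Suc show ?case
    by (auto simp: Ck_Suc_iff pd_mult simp del: Ck.simps(2) intro!: continuous_on_mult Ck_add
        intro: partial_intros)
qed

lemma smooth_add [smooth_intros]: "smooth f \<Longrightarrow> smooth g \<Longrightarrow> smooth (\<lambda>z. f z + g z)"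
  by (simp add: smooth_def Ck_add)

lemma smooth_mult [smooth_intros]: "smooth f \<Longrightarrow> smooth g \<Longrightarrow> smooth (\<lambda>z. f z * g z)"
  by (simp add: smooth_def Ck_mult)

lemma smooth_minus [smooth_intros]: "smooth f \<Longrightarrow> smooth (\<lambda>z. - f z)"
  using smooth_mult[OF smooth_const[of "-1"]] by simp

lemma smooth_diff [smooth_intros]: "smooth f \<Longrightarrow> smooth g \<Longrightarrow> smooth (\<lambda>z. f z - g z)"
  using smooth_add[OF _ smooth_minus] by simp

lemma smooth_power2 [smooth_intros]: "smooth f \<Longrightarrow> smooth (\<lambda>z. (f z)\<^sup>2)"
  by (simp add: power2_eq_square smooth_mult)

text \<open>Each source coordinate is either copied into one target coordinate or ignored. A partial
  derivative of the composite is then a partial derivative of \<open>f\<close> composed with the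
  same map, or zero, so induction on the order closes without a general chain rule. The instances
  are \<open>base\<close> and \<open>zero_section\<close>.\<close>

lemma smooth_compose:
  fixes \<phi> :: "('i \<Rightarrow> real) \<Rightarrow> ('j \<Rightarrow> real)"
  assumes "smooth f" and "continuous_on UNIV \<phi>"
    and pd_comp: "\<And>i. (\<exists>j. \<forall>z s. \<phi> (z(i := s)) = (\<phi> z)(j := s) \<and> \<phi> z j = z i) \<or> (\<forall>z s. \<phi> (z(i := s)) = \<phi> z)"
  shows "smooth (\<lambda>z. f (\<phi> z))"
proof -
  have "Ck n (\<lambda>z. f (\<phi> z))" if "smooth f" for n and f :: "('j \<Rightarrow> real) \<Rightarrow> real"
    using that
  proof (induction n arbitrary: f)
    case 0
    then show ?case
      using continuous_on_compose2[OF smooth_continuous[OF 0] assms(2)] by simp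
  next
    case (Suc n)
    have "continuous_on UNIV (\<lambda>z. f (\<phi> z))"
      using continuous_on_compose2[OF smooth_continuous[OF Suc.prems] assms(2)] by simp
    moreover have "(\<exists>d. \<forall>z. ((\<lambda>s. f (\<phi> (z(i := s)))) has_real_derivative d z) (at (z i)))
        \<and> Ck n (pd i (\<lambda>z. f (\<phi> z)))" for i
      using pd_comp[of i]
    proof (elim disjE exE)
      fix j
      assume j: "\<forall>z s. \<phi> (z(i := s)) = (\<phi> z)(j := s) \<and> \<phi> z j = z i"
      have *: "((\<lambda>s. f (\<phi> (z(i := s)))) has_real_derivative pd j f (\<phi> z)) (at (z i))" for z
        using has_derivative_pd_at[OF smooth_partially_differentiable[OF Suc.prems], of "\<phi> z" j] j
        by (simp del: fun_upd_apply)
      then have "pd i (\<lambda>z. f (\<phi> z)) = (\<lambda>z. pd j f (\<phi> z))"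
        by (intro ext pd_eqI)
      moreover have "Ck n (\<lambda>z. pd j f (\<phi> z))"
        by (rule Suc.IH) (rule smooth_pd[OF Suc.prems])
      ultimately show ?thesis
        using * by (auto intro!: exI[of _ "\<lambda>z. pd j f (\<phi> z)"])
    next
      assume *: "\<forall>z s. \<phi> (z(i := s)) = \<phi> z"
      then have "pd i (\<lambda>z. f (\<phi> z)) = (\<lambda>z. 0)"
        by (auto simp: pd_def)
      then show ?thesis
        using * by (auto simp: Ck_const intro!: exI[of _ "\<lambda>z. 0"])
    qed
    ultimately show ?case
      unfolding Ck_Suc_iff partially_differentiable_def real_differentiable_def by blast
  qed
  then show ?thesis
    using assms(1) by (simp add: smooth_def)
qed

lemma continuous_on_fun_upd2:
  fixes z :: "'i \<Rightarrow> real"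
  shows "continuous_on S (\<lambda>(a, b). z(i := a, j := b))"
proof (rule continuous_on_coordinatewise_then_product)
  fix k
  show "continuous_on S (\<lambda>x. (case x of (a, b) \<Rightarrow> z(i := a, j := b)) k)"
    by (cases "k = j"; cases "k = i") (auto simp: split_beta' intro!: continuous_intros)
qed

text \<open>Schwarz's theorem: \<open>f\<close> is written as an integral of \<open>pd i f\<close>
  in direction \<open>i\<close>, this is differentiated under the integral sign in direction
  \<open>j\<close>, and the fundamental theorem then gives the derivative in direction
  \<open>i\<close>.\<close>

lemma pd_commute:
  assumes f: "smooth f"
  shows "pd i (pd j f) = pd j (pd i f)"
proof (cases "i = j")
  case False
  show ?thesis
  proof
    fix z :: "'a \<Rightarrow> real"
    define e where "e a b = z(i := a, j := b)" for a b
    define G where "G a b = pd j (pd i f) (e a b)" for a b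
    \<comment> \<open>The point \<open>z i\<close> lies in the interior of \<open>{l..r}\<close>, so
      that the derivative within the interval is the full derivative at the end.\<close>
    define l r where "l = z i - 1" and "r = z i + 1"
    have lr: "l < z i" "z i < r" "l \<le> r"
      by (auto simp: l_def r_def)
    note pdf = smooth_partially_differentiable
    have da: "((\<lambda>a. h (e a b)) has_real_derivative pd i h (e a b)) (at a within S)"
      if "smooth h" for h a b S
      using has_derivative_pd[OF pdf[OF that], of "z(j := b)" i a] False
      by (auto simp: e_def fun_upd_twist intro: has_field_derivative_at_within)
    have db: "((\<lambda>b. h (e a b)) has_real_derivative pd j h (e a b)) (at b within S)"
      if "smooth h" for h a b S
      using has_derivative_pd[OF pdf[OF that], of "z(i := a)" j b]
      by (auto simp: e_def intro: has_field_derivative_at_within)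
    have cont: "continuous_on UNIV (\<lambda>(a, b). h (e a b))" if "smooth h" for h
      using continuous_on_compose2[OF smooth_continuous[OF that] continuous_on_fun_upd2[of UNIV z i j]]
      by (simp add: e_def split_beta')
    have conta: "continuous_on S (\<lambda>a. h (e a b))" if "smooth h" for h b S
      by (rule DERIV_continuous_on) (rule da[OF that])
    \<comment> \<open>The Leibniz rule expects the parameter before the integration variable, hence
      the swapped arguments.\<close>
    have cont': "continuous_on S (\<lambda>(b, a). G a b)" for S
    proof -
      have "continuous_on S (\<lambda>p. (\<lambda>(a, b). pd j (pd i f) (e a b)) (snd p, fst p))"
        by (rule continuous_on_compose2[OF cont]) (auto intro!: continuous_intros smooth_intros f)
      then show ?thesis
        by (simp add: G_def split_beta')
    qed
    have ftc: "f (e a b) = f (e l b) + integral {l..a} (\<lambda>s. pd i f (e s b))" if "l \<le> a" for a b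
    proof -
      have "((\<lambda>s. pd i f (e s b)) has_integral f (e a b) - f (e l b)) {l..a}"
        by (rule fundamental_theorem_of_calculus)
          (use that da[OF f] in \<open>auto simp: has_real_derivative_iff_has_vector_derivative\<close>)
      then show ?thesis
        by (simp add: integral_unique)
    qed
    have 1: "pd j f (e a b) = pd j f (e l b) + integral {l..a} (\<lambda>s. G s b)" if "l \<le> a" for a b
    proof -
      have "((\<lambda>b. integral (cbox l a) (\<lambda>s. pd i f (e s b))) has_real_derivative
          integral (cbox l a) (\<lambda>s. G s b)) (at b within UNIV)"
        by (rule leibniz_rule_field_derivative)
          (use cont' db[OF smooth_pd[OF f]] in
            \<open>auto simp: G_def intro!: integrable_continuous_real conta smooth_intros f\<close>)
      from DERIV_add[OF db[OF f, where a = l and b = b and S = UNIV] this]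
      have "((\<lambda>b. f (e a b)) has_real_derivative
          pd j f (e l b) + integral {l..a} (\<lambda>s. G s b)) (at b)"
        by (subst ftc[OF that]) simp
      from DERIV_unique[OF this db[OF f]] show ?thesis
        by simp
    qed
    have "((\<lambda>a. integral {l..a} (\<lambda>s. G s (z j))) has_real_derivative G (z i) (z j))
        (at (z i) within {l..r})"
      by (rule integral_has_real_derivative)
        (use lr in \<open>auto simp: G_def intro!: conta smooth_intros f\<close>)
    from DERIV_add[OF DERIV_const[where k = "pd j f (e l (z j))"] this]
    have "((\<lambda>a. pd j f (e l (z j)) + integral {l..a} (\<lambda>s. G s (z j)))
        has_real_derivative G (z i) (z j)) (at (z i) within {l..r})"
      by (simp only: add_0_left)
    then have "((\<lambda>a. pd j f (e a (z j))) has_real_derivative G (z i) (z j))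
        (at (z i) within {l..r})"
      by (rule has_field_derivative_transform_within[where d = 1]) (use lr in \<open>auto intro: 1[symmetric]\<close>)
    moreover have "at (z i) within {l..r} = at (z i)"
      by (rule at_within_interior) (use lr in simp)
    ultimately have "((\<lambda>a. pd j f (e a (z j))) has_real_derivative G (z i) (z j)) (at (z i))"
      by simp
    then have "pd i (pd j f) (e (z i) (z j)) = G (z i) (z j)"
      using da[OF smooth_pd[OF f], of j "z j" "z i" UNIV] by (blast intro: DERIV_unique)
    then show "pd i (pd j f) z = pd j (pd i f) z"
      by (simp add: G_def e_def)
  qed
qed simp

subsection \<open>Total derivatives\<close>

text \<open>Exactly what the calculus of \<open>D\<close> needs: the sum over jets is finite and the
  rules for \<open>pd\<close> apply. Unlike smoothness it is immediate for expressions already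
  differentiated.\<close>

definition finitary :: "dfun \<Rightarrow> bool" where
  "finitary F \<longleftrightarrow> partially_differentiable F \<and> (\<exists>C. finite C \<and> depends_on C F)"

lemma finitary_partially_differentiable [partial_intros]:
  "finitary F \<Longrightarrow> partially_differentiable F"
  by (simp add: finitary_def)

lemma finite_range_Base: "finite (range Base)"
  by (rule finite_imageI) simp

lemma finitary_finite_jets:
  assumes "finitary F"
  obtains K where "finite K" "\<And>\<alpha>. \<alpha> \<notin> K \<Longrightarrow> pd (Jet \<alpha>) F = (\<lambda>z. 0)"
proof -
  obtain C where C: "finite C" "depends_on C F"
    using assms finitary_def by blast
  show ?thesis
  proof
    show "finite (Jet -` C)"
      by (rule finite_vimageI[OF C(1)]) (simp add: inj_def)
  qed (use pd_eq_0_if_depends_on[OF C(2)] in auto)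
qed

text \<open>The index set in the definition of \<open>D\<close> varies with the function and the
  point. Any finite set containing the support may replace it, so several functions can share
  one.\<close>

lemma D_eq:
  assumes "finite K" and "\<And>\<alpha>. \<alpha> \<notin> K \<Longrightarrow> pd (Jet \<alpha>) F z = 0"
  shows "D i F z = pd (Base i) F z + (\<Sum>\<alpha>\<in>K. z (Jet (add_mset i \<alpha>)) * pd (Jet \<alpha>) F z)"
  unfolding D_def using assms by (intro arg_cong2[of _ _ _ _ "(+)"] sum.mono_neutral_left) auto

lemma depends_on_combine:
  assumes "\<exists>C. finite C \<and> depends_on C F" "\<exists>C. finite C \<and> depends_on C G"
  shows "\<exists>C. finite C \<and> depends_on C (\<lambda>z. h (F z) (G z))"
proof -
  obtain C C' where "finite C" "depends_on C F" "finite C'" "depends_on C' G"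
    using assms by blast
  then have "finite (C \<union> C')" "depends_on (C \<union> C') (\<lambda>z. h (F z) (G z))"
    unfolding depends_on_def by (auto intro!: arg_cong2[of _ _ _ _ h])
  then show ?thesis by blast
qed

section \<open>Functions of the base point\<close>

lemma depends_on_base: "depends_on (range Base) (\<lambda>z. f (base z))"
  by (auto simp: depends_on_def base_def)

lemma continuous_on_base: "continuous_on S base"
  unfolding base_def
  by (auto intro!: continuous_on_coordinatewise_then_product
      continuous_on_subset[OF continuous_on_product_coordinates])

lemma base_fun_upd [simp]:
  "base (z(Base i := s)) = (base z)(i := s)"
  "base (z(Jet \<alpha> := s)) = base z"
  by (auto simp: base_def)

lemma base_apply: "z (Base i) = base z i"
  by (simp add: base_def)

lemma smooth_base: "smooth f \<Longrightarrow> smooth (\<lambda>z. f (base z))"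
proof (rule smooth_compose[OF _ continuous_on_base])
  fix c
  show "(\<exists>j. \<forall>z s. base (z(c := s)) = (base z)(j := s) \<and> base z j = z c) \<or>
    (\<forall>z s. base (z(c := s)) = base z)"
    by (cases c) (auto simp: base_def intro!: exI)
qed

lemma
  assumes "partially_differentiable f"
  shows partially_differentiable_base: "partially_differentiable (\<lambda>z. f (base z))"
    and pd_Base_base: "pd (Base i) (\<lambda>z. f (base z)) = (\<lambda>z. pd i f (base z))"
proof -
  have *: "((\<lambda>s. f (base (z(Base i := s)))) has_real_derivative pd i f (base z)) (at (z (Base i)))"
    for z i
    using has_derivative_pd_at[OF assms, of "base z" i] by (simp add: base_apply del: fun_upd_apply)
  then show "pd (Base i) (\<lambda>z. f (base z)) = (\<lambda>z. pd i f (base z))"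
    by (intro ext pd_eqI)
  show "partially_differentiable (\<lambda>z. f (base z))"
  proof (rule partially_differentiableI)
    fix c z
    show "\<exists>d. ((\<lambda>s. f (base (z(c := s)))) has_real_derivative d) (at (z c))"
    proof (cases c)
      case (Base j)
      then show ?thesis using * by blast
    next
      case (Jet \<alpha>)
      then show ?thesis by (auto simp del: fun_upd_apply intro!: exI[of _ 0])
    qed
  qed
qed

lemma pd_Jet_base [simp]: "pd (Jet \<alpha>) (\<lambda>z. f (base z)) = (\<lambda>z. 0)"
  by (rule pd_eq_0_if_depends_on[OF depends_on_base]) auto

named_theorems finitary_intros

lemma finitary_const [finitary_intros]: "finitary (\<lambda>z. c)"
  by (auto simp: finitary_def depends_on_def intro!: partial_intros)

lemma finitary_coord [finitary_intros]: "finitary (\<lambda>z. z c)"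
  by (auto simp: finitary_def depends_on_def intro!: partial_intros exI[of _ "{c}"])

lemma finitary_base: "smooth f \<Longrightarrow> finitary (\<lambda>z. f (base z))"
  using finite_range_Base depends_on_base partially_differentiable_base
    smooth_partially_differentiable unfolding finitary_def by blast

lemma
  assumes "finitary F" "finitary G"
  shows finitary_add [finitary_intros]: "finitary (\<lambda>z. F z + G z)"
    and finitary_diff [finitary_intros]: "finitary (\<lambda>z. F z - G z)"
    and finitary_mult [finitary_intros]: "finitary (\<lambda>z. F z * G z)"
  using assms by (auto simp: finitary_def intro: partial_intros depends_on_combine)

lemma
  assumes "finitary F"
  shows finitary_minus [finitary_intros]: "finitary (\<lambda>z. - F z)"
    and finitary_power2 [finitary_intros]: "finitary (\<lambda>z. (F z)\<^sup>2)"
    and finitary_divide [finitary_intros]: "finitary (\<lambda>z. F z / c)"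
  using finitary_diff[OF finitary_const[of 0] assms] finitary_mult[OF assms assms]
    finitary_mult[OF assms finitary_const[of "1 / c"]]
  by (simp_all add: power2_eq_square)

lemma D_common:
  assumes "finitary F" "finitary G"
  obtains K where "finite K"
    "\<And>i z. D i F z = pd (Base i) F z + (\<Sum>\<alpha>\<in>K. z (Jet (add_mset i \<alpha>)) * pd (Jet \<alpha>) F z)"
    "\<And>i z. D i G z = pd (Base i) G z + (\<Sum>\<alpha>\<in>K. z (Jet (add_mset i \<alpha>)) * pd (Jet \<alpha>) G z)"
    "\<And>\<alpha>. \<alpha> \<notin> K \<Longrightarrow> pd (Jet \<alpha>) F = (\<lambda>z. 0)"
    "\<And>\<alpha>. \<alpha> \<notin> K \<Longrightarrow> pd (Jet \<alpha>) G = (\<lambda>z. 0)"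
proof -
  obtain K K' where K: "finite K" "\<And>\<alpha>. \<alpha> \<notin> K \<Longrightarrow> pd (Jet \<alpha>) F = (\<lambda>z. 0)"
    "finite K'" "\<And>\<alpha>. \<alpha> \<notin> K' \<Longrightarrow> pd (Jet \<alpha>) G = (\<lambda>z. 0)"
    using finitary_finite_jets[OF assms(1)] finitary_finite_jets[OF assms(2)] by metis
  show ?thesis
    by (rule that[of "K \<union> K'"]; (intro D_eq)?) (use K in auto)
qed

lemma
  assumes "finitary F" "finitary G"
  shows D_add: "D i (\<lambda>z. F z + G z) = (\<lambda>z. D i F z + D i G z)"
    and D_diff: "D i (\<lambda>z. F z - G z) = (\<lambda>z. D i F z - D i G z)"
    and D_mult: "D i (\<lambda>z. F z * G z) = (\<lambda>z. D i F z * G z + F z * D i G z)"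
proof -
  obtain K where K: "finite K"
    "\<And>i z. D i F z = pd (Base i) F z + (\<Sum>\<alpha>\<in>K. z (Jet (add_mset i \<alpha>)) * pd (Jet \<alpha>) F z)"
    "\<And>i z. D i G z = pd (Base i) G z + (\<Sum>\<alpha>\<in>K. z (Jet (add_mset i \<alpha>)) * pd (Jet \<alpha>) G z)"
    "\<And>\<alpha>. \<alpha> \<notin> K \<Longrightarrow> pd (Jet \<alpha>) F = (\<lambda>z. 0)"
    "\<And>\<alpha>. \<alpha> \<notin> K \<Longrightarrow> pd (Jet \<alpha>) G = (\<lambda>z. 0)"
    using D_common[OF assms] by blast
  note pd = pd_simps assms[THEN finitary_partially_differentiable]
  show "D i (\<lambda>z. F z + G z) = (\<lambda>z. D i F z + D i G z)"
    by (rule ext, subst D_eq[OF K(1)]) (simp_all add: pd K sum.distrib algebra_simps)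
  show "D i (\<lambda>z. F z - G z) = (\<lambda>z. D i F z - D i G z)"
    by (rule ext, subst D_eq[OF K(1)]) (simp_all add: pd K sum_subtractf algebra_simps)
  show "D i (\<lambda>z. F z * G z) = (\<lambda>z. D i F z * G z + F z * D i G z)"
    by (rule ext, subst D_eq[OF K(1)])
      (simp_all add: pd K sum.distrib sum_distrib_left sum_distrib_right algebra_simps)
qed

lemma D_const [simp]: "D i (\<lambda>z. c) = (\<lambda>z. 0)"
  by (rule ext, subst D_eq[of "{}"]) auto

lemma D_Base [simp]: "D i (\<lambda>z. z (Base j)) = (\<lambda>z. if i = j then 1 else 0)"
  by (rule ext, subst D_eq[of "{}"]) auto

lemma D_Jet [simp]: "D i (\<lambda>z. z (Jet \<alpha>)) = (\<lambda>z. z (Jet (add_mset i \<alpha>)))"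
  by (rule ext, subst D_eq[of "{\<alpha>}"]) auto

lemma D_base: "smooth f \<Longrightarrow> D i (\<lambda>z. f (base z)) = (\<lambda>z. pd i f (base z))"
  by (rule ext, subst D_eq[of "{}"])
    (auto simp: pd_Base_base smooth_partially_differentiable)

lemma
  assumes "finitary F"
  shows D_minus: "D i (\<lambda>z. - F z) = (\<lambda>z. - D i F z)"
    and D_power2: "D i (\<lambda>z. (F z)\<^sup>2) = (\<lambda>z. 2 * F z * D i F z)"
    and D_divide: "D i (\<lambda>z. F z / c) = (\<lambda>z. D i F z / c)"
  using D_diff[OF finitary_const[of 0] assms] D_mult[OF assms assms]
    D_mult[OF assms finitary_const[of "1 / c"]]
  by (simp_all add: power2_eq_square algebra_simps)

lemmas D_simps = D_add D_diff D_mult D_minus D_power2 D_divide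

lemma sum_UNIV_var: "(\<Sum>i\<in>UNIV. f i) = f vx + f vy + f vt" for f :: "var \<Rightarrow> real"
  by (simp add: UNIV_var)

lemma mset_pair_commute:
  "{#vy, vx#} = {#vx, vy#}" "{#vt, vx#} = {#vx, vt#}" "{#vt, vy#} = {#vy, vt#}"
  by (simp_all add: add_mset_commute)

lemma mset_pair_eq_iff:
  "{#a, b#} = {#c, d#} \<longleftrightarrow> a = c \<and> b = d \<or> a = d \<and> b = c"
  by (auto simp: add_eq_conv_ex)

subsection \<open>The equation and its Lagrangian\<close>

lemma pd_eqn:
  "pd (Base vx) eqn z = 8 * cx z * utt z - 4 * uyt z"
  "pd (Base vy) eqn z = 8 * cy z * utt z + 4 * uxt z"
  "pd (Base vt) eqn z = 0"
  "pd (Jet {#}) eqn z = 1"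
  "pd (Jet {#i#}) eqn z = 0"
  "pd (Jet {#vx, vx#}) eqn z = 1"
  "pd (Jet {#vx, vy#}) eqn z = 0"
  "pd (Jet {#vx, vt#}) eqn z = 4 * cy z"
  "pd (Jet {#vy, vy#}) eqn z = 1"
  "pd (Jet {#vy, vt#}) eqn z = - 4 * cx z"
  "pd (Jet {#vt, vt#}) eqn z = 4 * ((cx z)\<^sup>2 + (cy z)\<^sup>2)"
  unfolding eqn_def[abs_def] kohn_laplace_def
  by (simp_all add: pd_simps partial_intros mset_pair_eq_iff)

lemma pd_lagr:
  "pd (Base vx) lagr z = 4 * cx z * (ut z)\<^sup>2 - 2 * uy z * ut z"
  "pd (Base vy) lagr z = 4 * cy z * (ut z)\<^sup>2 + 2 * ux z * ut z"
  "pd (Base vt) lagr z = 0"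
  "pd (Jet {#}) lagr z = - uu z"
  "pd (Jet {#vx#}) lagr z = ux z + 2 * cy z * ut z"
  "pd (Jet {#vy#}) lagr z = uy z - 2 * cx z * ut z"
  "pd (Jet {#vt#}) lagr z = 4 * ((cx z)\<^sup>2 + (cy z)\<^sup>2) * ut z + 2 * cy z * ux z - 2 * cx z * uy z"
  unfolding lagr_def[abs_def]
  by (simp_all add: pd_simps partial_intros mset_pair_eq_iff)

lemma conserved_if_multiple_of_eqn:
  assumes "\<And>z. Div A z = Q z * eqn z"
  shows "conserved A"
  using assms by (simp add: conserved_def solution_def)

subsection \<open>Conservation laws\<close>

definition sublaplacian :: "(point \<Rightarrow> real) \<Rightarrow> point \<Rightarrow> real" where
  "sublaplacian f p = pd vx (pd vx f) p + pd vy (pd vy f) p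
     + 4 * ((p vx)\<^sup>2 + (p vy)\<^sup>2) * pd vt (pd vt f) p
     + 4 * p vy * pd vx (pd vt f) p - 4 * p vx * pd vy (pd vt f) p"

text \<open>The mixed derivatives in \<open>sublaplacian\<close> are nested in the same order as in
  \<open>jet\<close>, so both sides agree by unfolding.\<close>

lemma eqn_jet: "eqn (jet u p) = sublaplacian u p + u p"
  by (simp add: eqn_def kohn_laplace_def sublaplacian_def jet_def numeral_2_eq_2)

lemma solution_iff: "solution u \<longleftrightarrow> smooth u \<and> (\<forall>p. sublaplacian u p + u p = 0)"
  by (simp add: solution_def eqn_jet)

text \<open>As rewrite rules these sort mixed derivatives with \<open>vx\<close> outermost and
  \<open>vt\<close> innermost, the order used in \<open>sublaplacian\<close> and
  \<open>jet\<close>.\<close>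

lemma pd_commute_ordered:
  assumes "smooth f"
  shows "pd vy (pd vx f) = pd vx (pd vy f)" "pd vt (pd vx f) = pd vx (pd vt f)"
    "pd vt (pd vy f) = pd vy (pd vt f)"
  using pd_commute[OF assms] by blast+

lemma
  assumes "smooth f"
  shows smooth_base_pd: "smooth (\<lambda>z. f (base z))" "smooth (\<lambda>z. pd i f (base z))"
      "smooth (\<lambda>z. pd j (pd i f) (base z))"
    and finitary_base_pd: "finitary (\<lambda>z. f (base z))" "finitary (\<lambda>z. pd i f (base z))"
      "finitary (\<lambda>z. pd j (pd i f) (base z))"
    and D_base_pd: "D k (\<lambda>z. f (base z)) = (\<lambda>z. pd k f (base z))"
      "D k (\<lambda>z. pd i f (base z)) = (\<lambda>z. pd k (pd i f) (base z))"
  using assms by (auto intro: smooth_base finitary_base D_base smooth_pd)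

text \<open>Green's identity for the formally self-adjoint operator \<Delta> + 1, with
  \<open>u\<close> kept as a jet coordinate.\<close>

lemma Div_Wvec:
  assumes \<beta>: "smooth \<beta>"
  shows "Div (Wvec \<beta>) z = \<beta> (base z) * eqn z - uu z * (sublaplacian \<beta> (base z) + \<beta> (base z))"
  unfolding Div_def sum_UNIV_var eqn_def kohn_laplace_def sublaplacian_def
  by (simp add: D_simps D_base_pd[OF \<beta>] finitary_intros finitary_base_pd[OF \<beta>] \<beta> mset_pair_commute
      pd_commute_ordered base_apply[symmetric]) algebra

lemma conserved_Wvec:
  assumes "solution \<beta>"
  shows "conserved (Wvec \<beta>)"
  by (rule conserved_if_multiple_of_eqn[of _ "\<lambda>z. \<beta> (base z)"])
    (use assms in \<open>simp add: Div_Wvec solution_iff\<close>)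

lemma conserved_tau: "conserved tau_vec"
proof (rule conserved_if_multiple_of_eqn)
  show "Div tau_vec z = - ut z * eqn z" for z
    unfolding Div_def sum_UNIV_var eqn_def kohn_laplace_def
    by (simp add: Fu_def D_simps finitary_intros mset_pair_commute) algebra
qed

lemma conserved_sigma: "conserved sigma_vec"
proof (rule conserved_if_multiple_of_eqn)
  show "Div sigma_vec z = - (cy z * ux z - cx z * uy z) * eqn z" for z
    unfolding Div_def sum_UNIV_var eqn_def kohn_laplace_def
    by (simp add: Fu_def D_simps finitary_intros mset_pair_commute) algebra
qed

lemma conserved_chi: "conserved chi_vec"
proof (rule conserved_if_multiple_of_eqn)
  show "Div chi_vec z = - (ux z - 2 * cy z * ut z) * eqn z" for z
    unfolding Div_def sum_UNIV_var eqn_def kohn_laplace_def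
    by (simp add: Fu_def D_simps finitary_intros mset_pair_commute) algebra
qed

lemma conserved_upsilon: "conserved upsilon_vec"
proof (rule conserved_if_multiple_of_eqn)
  show "Div upsilon_vec z = - (uy z + 2 * cx z * ut z) * eqn z" for z
    unfolding Div_def sum_UNIV_var eqn_def kohn_laplace_def
    by (simp add: Fu_def D_simps finitary_intros mset_pair_commute) algebra
qed

section \<open>Verification of the Noether laws\<close>

lemma eta1_eq:
  "eta1 S i = (\<lambda>z. D i (eta S) z
     - (D i (xi S vx) z * ux z + D i (xi S vy) z * uy z + D i (xi S vt) z * ut z))"
  by (simp add: eta1_def[abs_def] sum_UNIV_var)

lemma prolong2_eqn:
  "prolong2 S eqn z = xi S vx z * (8 * cx z * utt z - 4 * uyt z)
     + xi S vy z * (8 * cy z * utt z + 4 * uxt z) + eta S z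
     + eta2 S vx vx z + eta2 S vy vy z + 4 * ((cx z)\<^sup>2 + (cy z)\<^sup>2) * eta2 S vt vt z
     + 4 * cy z * eta2 S vx vt z - 4 * cx z * eta2 S vy vt z"
  by (simp add: prolong2_def prolong1_def sum_UNIV_var pd_eqn)

lemma prolong1_lagr:
  "prolong1 S lagr z = xi S vx z * (4 * cx z * (ut z)\<^sup>2 - 2 * uy z * ut z)
     + xi S vy z * (4 * cy z * (ut z)\<^sup>2 + 2 * ux z * ut z) - eta S z * uu z
     + eta1 S vx z * (ux z + 2 * cy z * ut z) + eta1 S vy z * (uy z - 2 * cx z * ut z)
     + eta1 S vt z * (4 * ((cx z)\<^sup>2 + (cy z)\<^sup>2) * ut z + 2 * cy z * ux z - 2 * cx z * uy z)"
  by (simp add: prolong1_def sum_UNIV_var pd_lagr)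

named_theorems point_function_intros

lemma point_function_const [point_function_intros]: "point_function (\<lambda>z. c)"
  by (simp add: point_function_def smooth_const depends_on_def)

lemma point_function_base: "smooth f \<Longrightarrow> point_function (\<lambda>z. f (base z))"
  by (simp add: point_function_def smooth_base depends_on_mono[OF depends_on_base subset_insertI])

lemma point_function_Base [point_function_intros]: "point_function (\<lambda>z. z (Base i))"
  by (auto simp: point_function_def smooth_coord depends_on_def)

lemma
  assumes "point_function F" "point_function G"
  shows point_function_add [point_function_intros]: "point_function (\<lambda>z. F z + G z)"
    and point_function_mult [point_function_intros]: "point_function (\<lambda>z. F z * G z)"
  using assms unfolding point_function_def depends_on_def by (metis smooth_add, metis smooth_mult)

lemma point_function_minus [point_function_intros]:
  "point_function F \<Longrightarrow> point_function (\<lambda>z. - F z)"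
  using point_function_mult[OF point_function_const[of "-1"]] by simp

lemma differential_functionI:
  assumes "smooth F" "finitary F"
  shows "differential_function F"
  using assms by (simp add: differential_function_def finitary_def)

lemma noether_lawI:
  assumes "\<And>i. point_function (xi S i)" "point_function (eta S)"
    and "\<And>z. eqn z = 0 \<Longrightarrow> prolong2 S eqn z = 0"
    and "noether_gauge S \<phi>"
  shows "noether_law S (noether_current S \<phi>)"
  using assms unfolding noether_law_def noether_symmetry_def lie_point_symmetry_def point_vfield_def
  by blast

text \<open>For \<open>symT\<close>, \<open>symR\<close>, \<open>symX\<close> and
  \<open>symY\<close> the Lagrangian is strictly invariant, so the gauge can be taken zero.\<close>

lemma noether_gauge_0:
  assumes "\<And>z. prolong1 S lagr z + lagr z * (D vx (xi S vx) z + D vy (xi S vy) z + D vt (xi S vt) z) = 0"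
  shows "noether_gauge S (\<lambda>i z. 0)"
  unfolding noether_gauge_def sum_UNIV_var Div_def
  by (simp add: assms differential_functionI smooth_const finitary_const)

lemma vec_eqI:
  fixes A B :: vec
  assumes "\<And>z. A vx z = B vx z" "\<And>z. A vy z = B vy z" "\<And>z. A vt z = B vt z"
  shows "A = B"
proof (intro ext)
  fix i z
  show "A i z = B i z"
    using assms by (cases i) auto
qed

lemma noether_law_tau: "noether_law symT tau_vec"
proof -
  have "tau_vec = noether_current symT (\<lambda>i z. 0)"
    by (rule vec_eqI) (simp_all add: noether_current_def symT_def sum_UNIV_var pd_lagr Fu_def lagr_def, algebra+)
  moreover have "noether_law symT (noether_current symT (\<lambda>i z. 0))"
  proof (rule noether_lawI)
    show "point_function (xi symT i)" for i
      by (cases i) (simp_all add: symT_def point_function_intros)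
    show "noether_gauge symT (\<lambda>i z. 0)"
      by (rule noether_gauge_0) (simp add: prolong1_lagr eta1_eq symT_def)
    show "prolong2 symT eqn z = 0" for z
      by (simp add: prolong2_eqn eta1_eq eta2_def symT_def sum_UNIV_var)
  qed (simp add: symT_def point_function_const)
  ultimately show ?thesis by simp
qed

lemma noether_law_sigma: "noether_law symR sigma_vec"
proof -
  have "sigma_vec = noether_current symR (\<lambda>i z. 0)"
    by (rule vec_eqI) (simp_all add: noether_current_def symR_def sum_UNIV_var pd_lagr Fu_def lagr_def,
        simp_all add: algebra_simps power2_eq_square)
  moreover have "noether_law symR (noether_current symR (\<lambda>i z. 0))"
  proof (rule noether_lawI)
    show "point_function (xi symR i)" for i
      by (cases i) (simp_all add: symR_def point_function_intros)
    show "noether_gauge symR (\<lambda>i z. 0)"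
      by (rule noether_gauge_0)
        (simp add: prolong1_lagr eta1_eq symR_def D_simps finitary_intros lagr_def,
          simp add: algebra_simps power2_eq_square)
    show "prolong2 symR eqn z = 0" for z
      by (simp add: prolong2_eqn eta1_eq eta2_def symR_def sum_UNIV_var D_simps finitary_intros
          mset_pair_commute algebra_simps power2_eq_square)
  qed (simp add: symR_def point_function_const)
  ultimately show ?thesis by simp
qed

lemma noether_law_chi: "noether_law symX chi_vec"
proof -
  have "chi_vec = noether_current symX (\<lambda>i z. 0)"
    by (rule vec_eqI) (simp_all add: noether_current_def symX_def sum_UNIV_var pd_lagr Fu_def lagr_def, algebra+)
  moreover have "noether_law symX (noether_current symX (\<lambda>i z. 0))"
  proof (rule noether_lawI)
    show "point_function (xi symX i)" for i
      by (cases i) (simp_all add: symX_def point_function_intros)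
    show "noether_gauge symX (\<lambda>i z. 0)"
      by (rule noether_gauge_0)
        (simp add: prolong1_lagr eta1_eq symX_def D_simps finitary_intros lagr_def,
          simp add: algebra_simps power2_eq_square)
    show "prolong2 symX eqn z = 0" for z
      by (simp add: prolong2_eqn eta1_eq eta2_def symX_def sum_UNIV_var D_simps finitary_intros
          mset_pair_commute)
  qed (simp add: symX_def point_function_const)
  ultimately show ?thesis by simp
qed

lemma noether_law_upsilon: "noether_law symY upsilon_vec"
proof -
  have "upsilon_vec = noether_current symY (\<lambda>i z. 0)"
    by (rule vec_eqI) (simp_all add: noether_current_def symY_def sum_UNIV_var pd_lagr Fu_def lagr_def, algebra+)
  moreover have "noether_law symY (noether_current symY (\<lambda>i z. 0))"
  proof (rule noether_lawI)
    show "point_function (xi symY i)" for i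
      by (cases i) (simp_all add: symY_def point_function_intros)
    show "noether_gauge symY (\<lambda>i z. 0)"
      by (rule noether_gauge_0)
        (simp add: prolong1_lagr eta1_eq symY_def D_simps finitary_intros lagr_def,
          simp add: algebra_simps power2_eq_square)
    show "prolong2 symY eqn z = 0" for z
      by (simp add: prolong2_eqn eta1_eq eta2_def symY_def sum_UNIV_var D_simps finitary_intros
          mset_pair_commute)
  qed (simp add: symY_def point_function_const)
  ultimately show ?thesis by simp
qed

text \<open>Component \<open>i\<close> is \<open>u\<close> times the derivative of the Lagrangian by
  \<open>u\<^sub>i\<close> with \<beta> inserted for \<open>u\<close>. The Lagrangian is quadratic,
  so the divergence of this vector is the polarised first order part plus \<open>u\<close>
  \<Delta>\<beta>, and \<Delta>\<beta> = -\<beta> turns the last term into the zeroth order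
  part.\<close>

primrec W_gauge :: "(point \<Rightarrow> real) \<Rightarrow> vec" where
  "W_gauge \<beta> vx = (\<lambda>z. uu z * (pd vx \<beta> (base z) + 2 * cy z * pd vt \<beta> (base z)))"
| "W_gauge \<beta> vy = (\<lambda>z. uu z * (pd vy \<beta> (base z) - 2 * cx z * pd vt \<beta> (base z)))"
| "W_gauge \<beta> vt = (\<lambda>z. 2 * uu z * (cy z * pd vx \<beta> (base z) - cx z * pd vy \<beta> (base z)
     + 2 * ((cx z)\<^sup>2 + (cy z)\<^sup>2) * pd vt \<beta> (base z)))"

lemma W_gauge_smooth: "smooth \<beta> \<Longrightarrow> smooth (W_gauge \<beta> i)"
  by (cases i) (simp_all add: smooth_intros smooth_base_pd)

lemma W_gauge_finitary: "smooth \<beta> \<Longrightarrow> finitary (W_gauge \<beta> i)"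
  by (cases i) (simp_all add: finitary_intros finitary_base_pd)

lemma Div_W_gauge:
  assumes \<beta>: "smooth \<beta>"
  shows "Div (W_gauge \<beta>) z = pd vx \<beta> (base z) * (ux z + 2 * cy z * ut z)
    + pd vy \<beta> (base z) * (uy z - 2 * cx z * ut z)
    + pd vt \<beta> (base z) * (4 * ((cx z)\<^sup>2 + (cy z)\<^sup>2) * ut z + 2 * cy z * ux z - 2 * cx z * uy z)
    + uu z * sublaplacian \<beta> (base z)"
  unfolding Div_def sum_UNIV_var sublaplacian_def
  by (simp add: D_simps D_base_pd[OF \<beta>] finitary_intros finitary_base_pd[OF \<beta>] \<beta> mset_pair_commute
      pd_commute_ordered base_apply[symmetric]) algebra

lemma noether_law_W:
  assumes "solution \<beta>"
  shows "noether_law (symW \<beta>) (Wvec \<beta>)"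
proof -
  have \<beta>: "smooth \<beta>" and sub: "sublaplacian \<beta> p = - \<beta> p" for p
    using assms by (auto simp: solution_iff add_eq_0_iff2)
  have "Wvec \<beta> = noether_current (symW \<beta>) (W_gauge \<beta>)"
    by (rule vec_eqI) (simp_all add: noether_current_def symW_def sum_UNIV_var pd_lagr algebra_simps power2_eq_square)
  moreover have "noether_law (symW \<beta>) (noether_current (symW \<beta>) (W_gauge \<beta>))"
  proof (rule noether_lawI)
    show "noether_gauge (symW \<beta>) (W_gauge \<beta>)"
      unfolding noether_gauge_def
      by (auto simp: prolong1_lagr eta1_eq symW_def D_base_pd[OF \<beta>] Div_W_gauge \<beta> sub
          intro!: differential_functionI W_gauge_smooth W_gauge_finitary)
    show "prolong2 (symW \<beta>) eqn z = 0" for z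
      using sub[of "base z"]
      by (simp add: prolong2_eqn eta1_eq eta2_def symW_def sum_UNIV_var D_base_pd[OF \<beta>] D_simps
          finitary_base_pd[OF \<beta>] finitary_intros mset_pair_commute \<beta> sublaplacian_def pd_commute_ordered
          base_apply)
  qed (simp_all add: symW_def point_function_const point_function_base \<beta>)
  ultimately show ?thesis by simp
qed

subsection \<open>Determining equations\<close>

abbreviation pu :: "dfun \<Rightarrow> dfun" where "pu \<equiv> pd (Jet {#})"
abbreviation pb :: "var \<Rightarrow> dfun \<Rightarrow> dfun" where "pb i \<equiv> pd (Base i)"

lemma point_function_smooth: "point_function F \<Longrightarrow> smooth F"
  by (simp add: point_function_def)

lemma point_function_pd: "point_function F \<Longrightarrow> point_function (pd c F)"
  by (simp add: point_function_def smooth_pd depends_on_pd)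

lemma point_function_finitary: "point_function F \<Longrightarrow> finitary F"
  unfolding point_function_def finitary_def
  using finite_range_Base smooth_partially_differentiable by blast

lemma point_function_diff:
  "point_function F \<Longrightarrow> point_function G \<Longrightarrow> point_function (\<lambda>z. F z - G z)"
  using point_function_add[OF _ point_function_minus] by simp

lemma point_function_value: "point_function uu"
  by (auto simp: point_function_def smooth_coord depends_on_def)

lemma D_point:
  assumes "point_function F"
  shows "D i F = (\<lambda>z. pb i F z + z (Jet {#i#}) * pu F z)"
proof
  fix z
  have "D i F z = pb i F z + (\<Sum>\<alpha>\<in>{{#}}. z (Jet (add_mset i \<alpha>)) * pd (Jet \<alpha>) F z)"
  proof (rule D_eq)
    fix \<alpha> :: "var multiset"
    assume "\<alpha> \<notin> {{#}}"
    then show "pd (Jet \<alpha>) F z = 0"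
      using assms pd_eq_0_if_depends_on[of "insert (Jet {#}) (range Base)" F "Jet \<alpha>"]
      by (auto simp: point_function_def fun_eq_iff image_iff)
  qed simp
  then show "D i F z = pb i F z + z (Jet {#i#}) * pu F z"
    by simp
qed

lemma finitary_D_point: "point_function F \<Longrightarrow> finitary (D i F)"
  by (simp add: D_point finitary_intros point_function_finitary point_function_pd)

lemma D_D_point:
  assumes "point_function F"
  shows "D j (D i F) z = pb j (pb i F) z + z (Jet {#j#}) * pu (pb i F) z
    + z (Jet {#j, i#}) * pu F z + z (Jet {#i#}) * (pb j (pu F) z + z (Jet {#j#}) * pu (pu F) z)"
  using assms
  by (simp add: D_point D_simps finitary_intros point_function_finitary point_function_pd)

lemma eta2_point:
  assumes "point_vfield S"
  shows "eta2 S i j z = D j (D i (eta S)) z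
    - (D j (D i (xi S vx)) z * ux z + D j (D i (xi S vy)) z * uy z + D j (D i (xi S vt)) z * ut z)
    - (D i (xi S vx) z * z (Jet {#j, vx#}) + D i (xi S vy) z * z (Jet {#j, vy#})
        + D i (xi S vt) z * z (Jet {#j, vt#}))
    - (D j (xi S vx) z * z (Jet {#i, vx#}) + D j (xi S vy) z * z (Jet {#i, vy#})
        + D j (xi S vt) z * z (Jet {#i, vt#}))"
proof -
  have "point_function (xi S k)" "point_function (eta S)" for k
    using assms by (auto simp: point_vfield_def)
  then show ?thesis
    by (simp add: eta2_def eta1_eq sum_UNIV_var D_simps finitary_intros finitary_D_point)
qed

section \<open>Testing the symmetry condition on free second jets\<close>

definition jet2 :: "jetpoint \<Rightarrow> real \<Rightarrow> real \<Rightarrow> real \<Rightarrow> real \<Rightarrow> real \<Rightarrow> real \<Rightarrow> real \<Rightarrow> real \<Rightarrow> real \<Rightarrow> jetpoint"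
  where "jet2 z k1 k2 k3 m11 m12 m13 m22 m23 m33 c = (case c of
      Base i \<Rightarrow> z c
    | Jet \<alpha> \<Rightarrow> if \<alpha> = {#} then z c
        else if \<alpha> = {#vx#} then k1 else if \<alpha> = {#vy#} then k2 else if \<alpha> = {#vt#} then k3
        else if \<alpha> = {#vx, vx#} then m11 else if \<alpha> = {#vx, vy#} then m12
        else if \<alpha> = {#vx, vt#} then m13 else if \<alpha> = {#vy, vy#} then m22
        else if \<alpha> = {#vy, vt#} then m23 else if \<alpha> = {#vt, vt#} then m33 else 0)"

context
  fixes z :: jetpoint and k1 k2 k3 m11 m12 m13 m22 m23 m33 :: real
begin

abbreviation "jz \<equiv> jet2 z k1 k2 k3 m11 m12 m13 m22 m23 m33"

lemma jet2_simps [simp]: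
  "jz (Base i) = z (Base i)" "uu jz = uu z" "ux jz = k1" "uy jz = k2" "ut jz = k3"
  "uxx jz = m11" "jz (Jet {#vx, vy#}) = m12" "uxt jz = m13" "uyy jz = m22" "uyt jz = m23" "utt jz = m33"
  "base jz = base z"
  by (simp_all add: jet2_def mset_pair_eq_iff base_def)

lemma point_function_jet2: "point_function F \<Longrightarrow> F jz = F z"
  unfolding point_function_def depends_on_def by (auto intro!: ext)

end

text \<open>The equation is solved for \<open>u\<^sub>x\<^sub>x\<close>, so the remaining jet
  coordinates parametrise its zero set freely.\<close>

lemma eqn_jet2:
  "eqn (jet2 z k1 k2 k3 m11 m12 m13 m22 m23 m33) = 0 \<longleftrightarrow>
    m11 = - uu z - m22 - 4 * ((cx z)\<^sup>2 + (cy z)\<^sup>2) * m33 - 4 * cy z * m13 + 4 * cx z * m23"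
  unfolding eqn_def kohn_laplace_def jet2_simps by linarith

text \<open>After \<open>u\<^sub>x\<^sub>x\<close> is eliminated, the products of a first and a
  second derivative have coefficients that come only from the \<open>u\<close>-derivatives of \<xi>,
  and these must vanish separately.\<close>

lemma pu_xi_eq_0:
  assumes S: "lie_point_symmetry S"
  shows "pu (xi S k) z = 0"
proof -
  have S': "point_vfield S"
    using S by (simp add: lie_point_symmetry_def)
  have pf: "point_function (xi S k)" "point_function (eta S)" for k
    using S' by (auto simp: point_vfield_def)
  define G where "G k1 k2 k3 m12 m13 =
    prolong2 S eqn (jet2 z k1 k2 k3 (- uu z - 4 * cy z * m13) m12 m13 0 0 0)" for k1 k2 k3 m12 m13
  have G0: "G k1 k2 k3 m12 m13 = 0" for k1 k2 k3 m12 m13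
    unfolding G_def using S by (simp add: lie_point_symmetry_def eqn_jet2)
  note second = prolong2_eqn eta2_point[OF S'] D_D_point[OF pf(1)] D_D_point[OF pf(2)]
  note expand = D_point[OF pf(1)] D_point[OF pf(2)] point_function_jet2 pf point_function_pd
    mset_pair_commute algebra_simps
  \<comment> \<open>mixed second differences isolate the terms \<open>u\<^sub>k u\<^sub>i\<^sub>j\<close>\<close>
  have "G 1 0 0 1 0 - G 1 0 0 0 0 - G 0 0 0 1 0 + G 0 0 0 0 0 = - 2 * pu (xi S vy) z"
    unfolding G_def second by (simp add: expand)
  then have y: "pu (xi S vy) z = 0"
    by (simp add: G0)
  have "G 0 1 0 1 0 - G 0 1 0 0 0 - G 0 0 0 1 0 + G 0 0 0 0 0 = - 2 * pu (xi S vx) z"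
    unfolding G_def second by (simp add: expand)
  then have x: "pu (xi S vx) z = 0"
    by (simp add: G0)
  \<comment> \<open>Both the eliminated \<open>u\<^sub>x\<^sub>x\<close> and the term with
    \<open>u\<^sub>x\<^sub>t\<close> in the equation contribute \<open>pu (xi S vx)\<close>, so
    \<open>x\<close> has to be known first.\<close>
  have "G 1 0 0 0 1 - G 1 0 0 0 0 - G 0 0 0 0 1 + G 0 0 0 0 0
      = - 2 * pu (xi S vt) z + 4 * cy z * pu (xi S vx) z"
    unfolding G_def second by (simp add: expand)
  then have "pu (xi S vt) z = 0"
    by (simp add: G0 x)
  with x y show ?thesis
    by (cases k) auto
qed

text \<open>The jet over \<open>p\<close> with all derivative coordinates zero; it turns a function
  on jet space into a function on the base.\<close>

definition zero_section :: "point \<Rightarrow> jetpoint" where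
  "zero_section p c = (case c of Base i \<Rightarrow> p i | Jet \<alpha> \<Rightarrow> 0)"

lemma zero_section_simps [simp]:
  "zero_section p (Base i) = p i" "zero_section p (Jet \<alpha>) = 0" "base (zero_section p) = p"
  by (simp_all add: zero_section_def base_def)

lemma smooth_zero_section:
  assumes "smooth F"
  shows "smooth (\<lambda>p. F (zero_section p))"
proof (rule smooth_compose[OF assms])
  show "continuous_on UNIV zero_section"
  proof (rule continuous_on_coordinatewise_then_product)
    show "continuous_on UNIV (\<lambda>p. zero_section p c)" for c
      by (cases c) (auto intro: continuous_on_product_coordinates)
  qed
  fix i
  have "zero_section (p(i := s)) = (zero_section p)(Base i := s)" for p s
    by (auto simp: zero_section_def split: coord.split)
  then show "(\<exists>j. \<forall>p s. zero_section (p(i := s)) = (zero_section p)(j := s) \<and> zero_section p j = p i) \<or>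
      (\<forall>p s. zero_section (p(i := s)) = zero_section p)"
    by (auto intro!: exI[of _ "Base i"])
qed

text \<open>Moving the coordinate \<open>u\<close> to zero changes nothing, and the jets of positive
  order do not enter a point function.\<close>

lemma point_function_eq_base:
  assumes F: "point_function F" and "\<And>z. pu F z = 0"
  shows "F = (\<lambda>z. F (zero_section (base z)))"
proof
  fix z
  have "F z = F (z(Jet {#} := 0))"
    by (rule eq_on_finite_difference_if_pd_eq_0[where C = "{Jet {#}}"])
      (use assms point_function_smooth[OF F] in \<open>auto intro: smooth_partially_differentiable\<close>)
  also have "\<dots> = F (zero_section (base z))"
    using F unfolding point_function_def depends_on_def by (auto simp: base_def)
  finally show "F z = F (zero_section (base z))" .
qed

text \<open>Once \<xi> depends on the base point only, the sole term quadratic in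
  \<open>u\<^sub>x\<close> comes from the second \<open>u\<close>-derivative of \<eta>.\<close>

lemma pu_pu_eta_eq_0:
  assumes S: "lie_point_symmetry S"
  shows "pu (pu (eta S)) z = 0"
proof -
  have S': "point_vfield S"
    using S by (simp add: lie_point_symmetry_def)
  have pf: "point_function (xi S k)" "point_function (eta S)" for k
    using S' by (auto simp: point_vfield_def)
  have pu_xi: "pu (xi S k) = (\<lambda>z. 0)" for k
    by (rule ext) (rule pu_xi_eq_0[OF S])
  define f where "f k p = xi S k (zero_section p)" for k p
  have "smooth (f k)" for k
    unfolding f_def by (rule smooth_zero_section) (rule point_function_smooth[OF pf(1)])
  then have f: "partially_differentiable (f k)" for k
    by (rule smooth_partially_differentiable)
  have xi: "xi S k = (\<lambda>z. f k (base z))" for k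
    unfolding f_def by (rule point_function_eq_base[OF pf(1) pu_xi_eq_0[OF S]])
  have pu_pb_xi: "pu (pb i (xi S k)) = (\<lambda>z. 0)" for i k
    unfolding xi by (simp add: pd_Base_base[OF f])
  define G where "G k1 =
    prolong2 S eqn (jet2 z k1 0 0 (- uu z) 0 0 0 0 0)" for k1
  have G0: "G k1 = 0" for k1
    unfolding G_def using S by (simp add: lie_point_symmetry_def eqn_jet2)
  \<comment> \<open>A symmetric second difference in \<open>u\<^sub>x\<close> cancels the constant
    and linear terms and doubles the quadratic coefficient.\<close>
  have "G 1 - 2 * G 0 + G (-1) = 2 * pu (pu (eta S)) z"
    unfolding G_def prolong2_eqn eta2_point[OF S'] D_D_point[OF pf(1)] D_D_point[OF pf(2)]
    by (simp add: D_point[OF pf(1)] D_point[OF pf(2)] pu_xi pu_pb_xi point_function_jet2 pf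
        point_function_pd mset_pair_commute algebra_simps)
  then show ?thesis
    by (simp add: G0)
qed

text \<open>The functions are the values at \<open>u = 0\<close> of \<xi>, of the
  \<open>u\<close>-derivative of \<eta>, and of \<eta>. Subtracting \<alpha> \<open>u\<close> from
  \<eta> leaves a point function without \<open>u\<close>-derivative.\<close>

lemma lie_point_symmetry_affine:
  assumes S: "lie_point_symmetry S"
  obtains f \<alpha> \<beta> where "\<And>k. smooth (f k)" "smooth \<alpha>" "smooth \<beta>"
    "S = VField (\<lambda>k z. f k (base z)) (\<lambda>z. \<alpha> (base z) * uu z + \<beta> (base z))"
proof -
  have pf: "point_function (xi S k)" "point_function (eta S)" for k
    using S by (auto simp: point_vfield_def lie_point_symmetry_def)
  define f where "f k p = xi S k (zero_section p)" for k p
  define \<alpha> where "\<alpha> p = pu (eta S) (zero_section p)" for p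
  define \<beta> where "\<beta> p = eta S (zero_section p)" for p
  have smooth: "smooth (f k)" "smooth \<alpha>" "smooth \<beta>" for k
    unfolding f_def \<alpha>_def \<beta>_def
    by (intro smooth_zero_section point_function_smooth pf point_function_pd)+
  have xi: "xi S k = (\<lambda>z. f k (base z))" for k
    unfolding f_def by (rule point_function_eq_base[OF pf(1) pu_xi_eq_0[OF S]])
  have pu: "pu (eta S) = (\<lambda>z. \<alpha> (base z))"
    unfolding \<alpha>_def
    by (rule point_function_eq_base[OF point_function_pd[OF pf(2)] pu_pu_eta_eq_0[OF S]])
  let ?E = "\<lambda>z. eta S z - \<alpha> (base z) * uu z"
  have "?E = (\<lambda>z. ?E (zero_section (base z)))"
  proof (rule point_function_eq_base)
    show "point_function ?E"
      by (intro point_function_diff point_function_mult point_function_base point_function_value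
          smooth pf)
    show "pu ?E z = 0" for z
      using point_function_smooth[OF pf(2)] smooth_base[OF smooth(2)]
      by (simp add: pd_simps partial_intros pu)
  qed
  then have E: "?E z = ?E (zero_section (base z))" for z
    by (rule fun_cong)
  have "eta S z = \<alpha> (base z) * uu z + \<beta> (base z)" for z
    using E[of z] unfolding \<beta>_def zero_section_simps by linarith
  then have "eta S = (\<lambda>z. \<alpha> (base z) * uu z + \<beta> (base z))"
    by (rule ext)
  moreover have "xi S = (\<lambda>k z. f k (base z))"
    using xi by (rule ext)
  ultimately have "S = VField (\<lambda>k z. f k (base z)) (\<lambda>z. \<alpha> (base z) * uu z + \<beta> (base z))"
    by (cases S) simp
  with smooth show ?thesis
    by (rule that)
qed

subsection \<open>Conformal fields of the horizontal frame\<close>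

definition hX :: "(point \<Rightarrow> real) \<Rightarrow> point \<Rightarrow> real" where
  "hX f p = pd vx f p + 2 * p vy * pd vt f p"

definition hY :: "(point \<Rightarrow> real) \<Rightarrow> point \<Rightarrow> real" where
  "hY f p = pd vy f p - 2 * p vx * pd vt f p"

lemma smooth_hX [smooth_intros]: "smooth f \<Longrightarrow> smooth (hX f)"
  unfolding hX_def[abs_def] by (intro smooth_intros)

lemma smooth_hY [smooth_intros]: "smooth f \<Longrightarrow> smooth (hY f)"
  unfolding hY_def[abs_def] by (intro smooth_intros)

text \<open>The structure used below: the operator is a sum of squares, the bracket of the frame is
  a multiple of the \<open>t\<close>-derivative, and the \<open>t\<close>-derivative is
  central.\<close>

lemma
  assumes f: "smooth f"
  shows sublaplacian_eq: "sublaplacian f p = hX (hX f) p + hY (hY f) p"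
    and hX_hY_commutator: "hX (hY f) p - hY (hX f) p = - 4 * pd vt f p"
    and pd_vt_hX: "pd vt (hX f) = hX (pd vt f)"
    and pd_vt_hY: "pd vt (hY f) = hY (pd vt f)"
proof -
  note s = pd_simps partial_intros smooth_pd f pd_commute_ordered
  show "sublaplacian f p = hX (hX f) p + hY (hY f) p"
    unfolding hX_def[abs_def] hY_def[abs_def] sublaplacian_def
    by (simp add: s algebra_simps power2_eq_square)
  show "hX (hY f) p - hY (hX f) p = - 4 * pd vt f p"
    unfolding hX_def[abs_def] hY_def[abs_def] by (simp add: s algebra_simps)
  show "pd vt (hX f) = hX (pd vt f)"
    unfolding hX_def[abs_def] by (simp add: s)
  show "pd vt (hY f) = hY (pd vt f)"
    unfolding hY_def[abs_def] by (simp add: s)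
qed

lemma h_simps:
  assumes "smooth f" "smooth g"
  shows "hX (\<lambda>p. f p + g p) = (\<lambda>p. hX f p + hX g p)"
    "hY (\<lambda>p. f p + g p) = (\<lambda>p. hY f p + hY g p)"
    "hX (\<lambda>p. f p - g p) = (\<lambda>p. hX f p - hX g p)"
    "hY (\<lambda>p. f p - g p) = (\<lambda>p. hY f p - hY g p)"
    "hX (\<lambda>p. f p * g p) = (\<lambda>p. hX f p * g p + f p * hX g p)"
    "hY (\<lambda>p. f p * g p) = (\<lambda>p. hY f p * g p + f p * hY g p)"
  using assms[THEN smooth_partially_differentiable]
  by (auto simp: hX_def[abs_def] hY_def[abs_def] pd_simps algebra_simps)

lemma h_minus:
  assumes "smooth f"
  shows "hX (\<lambda>p. - f p) = (\<lambda>p. - hX f p)" "hY (\<lambda>p. - f p) = (\<lambda>p. - hY f p)"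
  using assms[THEN smooth_partially_differentiable]
  by (auto simp: hX_def[abs_def] hY_def[abs_def] pd_simps algebra_simps)

lemma h_cmult:
  assumes "smooth f"
  shows "hX (\<lambda>p. c * f p) = (\<lambda>p. c * hX f p)" "hY (\<lambda>p. c * f p) = (\<lambda>p. c * hY f p)"
    "pd i (\<lambda>p. c * f p) = (\<lambda>p. c * pd i f p)"
  using assms[THEN smooth_partially_differentiable]
  by (auto simp: hX_def[abs_def] hY_def[abs_def] pd_simps partial_intros algebra_simps)

text \<open>The frame is bracket generating: the commutator makes the \<open>t\<close>-derivative
  vanish, and then the other two vanish as well.\<close>

lemma constant_if_horizontally_constant:
  assumes f: "smooth f" and X: "\<And>p. hX f p = 0" and Y: "\<And>p. hY f p = 0"
  shows "f p = f q"
proof -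
  have "hX f = (\<lambda>p. 0)" "hY f = (\<lambda>p. 0)"
    using X Y by auto
  then have t: "pd vt f p = 0" for p
    using hX_hY_commutator[OF f, of p] by (simp add: hX_def hY_def)
  then have "pd vx f p = 0" "pd vy f p = 0" for p
    using X[of p] Y[of p] by (simp_all add: hX_def hY_def)
  with t have "pd i f p = 0" for i p
    by (cases i) auto
  then show ?thesis
    by (intro eq_on_finite_difference_if_pd_eq_0[of f UNIV] smooth_partially_differentiable f) auto
qed

text \<open>With \<open>u\<^sub>x\<^sub>x\<close> eliminated, the equations are in this order the
  coefficients of \<open>u\<^sub>y\<^sub>y\<close>, \<open>u\<^sub>x\<^sub>y\<close>,
  \<open>u\<^sub>x\<^sub>t\<close>, \<open>u\<^sub>y\<^sub>t\<close>, \<open>u\<^sub>x\<close>,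
  \<open>u\<^sub>y\<close>, \<open>u\<close> and the term free of \<open>u\<close>. The first two
  are Cauchy-Riemann equations up to sign, in the horizontal frame.\<close>

lemma affine_symmetry_equations:
  assumes S: "lie_point_symmetry
      (VField (\<lambda>k z. f k (base z)) (\<lambda>z. \<alpha> (base z) * uu z + \<beta> (base z)))"
    and f: "\<And>k. smooth (f k)" and \<alpha>: "smooth \<alpha>" and \<beta>: "smooth \<beta>"
  shows "hX (f vx) p = hY (f vy) p" "hY (f vx) p = - hX (f vy) p"
    "hX (f vt) p = 2 * f vy p - 2 * p vy * hX (f vx) p + 2 * p vx * hY (f vx) p
       + 4 * p vy * hX (f vx) p"
    "hY (f vt) p = - 2 * f vx p - 2 * p vy * hX (f vy) p + 2 * p vx * hY (f vy) p
       - 4 * p vx * hX (f vx) p"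
    "2 * hX \<alpha> p = sublaplacian (f vx) p" "2 * hY \<alpha> p = sublaplacian (f vy) p"
    "sublaplacian \<alpha> p + 2 * hX (f vx) p = 0" "sublaplacian \<beta> p + \<beta> p = 0"
proof -
  let ?S = "VField (\<lambda>k z. f k (base z)) (\<lambda>z. \<alpha> (base z) * uu z + \<beta> (base z))"
  define z where "z u = (zero_section p)(Jet {#} := u)" for u
  have z [simp]: "base (z u) = p" "uu (z u) = u" "z u (Base i) = p i" for u i
    by (auto simp: z_def base_def)
  define G where "G u k1 k2 m12 m13 m22 m23 = prolong2 ?S eqn
      (jet2 (z u) k1 k2 0 (- u - m22 - 4 * p vy * m13 + 4 * p vx * m23) m12 m13 m22 m23 0)"
    for u k1 k2 m12 m13 m22 m23
  have G0: "G u k1 k2 m12 m13 m22 m23 = 0" for u k1 k2 m12 m13 m22 m23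
    unfolding G_def using S by (simp add: lie_point_symmetry_def eqn_jet2)
  note D = D_base_pd[OF f] D_base_pd[OF \<alpha>] D_base_pd[OF \<beta>]
    finitary_base_pd[OF f] finitary_base_pd[OF \<alpha>] finitary_base_pd[OF \<beta>]
    finitary_intros D_simps mset_pair_commute
    pd_commute_ordered[OF f] pd_commute_ordered[OF \<alpha>] pd_commute_ordered[OF \<beta>]
  \<comment> \<open>The prolongation is affine in the jets and is regrouped by the frame, so that
    each coefficient is an expression in \<open>hX\<close>, \<open>hY\<close> and
    \<open>sublaplacian\<close>.\<close>
  have expand: "prolong2 ?S eqn w = f vx (base w) * (8 * cx w * utt w - 4 * uyt w)
     + f vy (base w) * (8 * cy w * utt w + 4 * uxt w)
     + (\<alpha> (base w) * uu w + \<beta> (base w)) + \<alpha> (base w) * kohn_laplace w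
     + uu w * sublaplacian \<alpha> (base w) + sublaplacian \<beta> (base w)
     + 2 * hX \<alpha> (base w) * (ux w + 2 * cy w * ut w) + 2 * hY \<alpha> (base w) * (uy w - 2 * cx w * ut w)
     - sublaplacian (f vx) (base w) * ux w - sublaplacian (f vy) (base w) * uy w
     - sublaplacian (f vt) (base w) * ut w
     - 2 * hX (f vx) (base w) * (uxx w + 2 * cy w * uxt w)
     - 2 * hY (f vx) (base w) * (w (Jet {#vx, vy#}) - 2 * cx w * uxt w)
     - 2 * hX (f vy) (base w) * (w (Jet {#vx, vy#}) + 2 * cy w * uyt w)
     - 2 * hY (f vy) (base w) * (uyy w - 2 * cx w * uyt w)
     - 2 * hX (f vt) (base w) * (uxt w + 2 * cy w * utt w)
     - 2 * hY (f vt) (base w) * (uyt w - 2 * cx w * utt w)" for w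
    unfolding prolong2_eqn
    by (simp add: eta1_eq eta2_def sum_UNIV_var D)
      (simp add: kohn_laplace_def sublaplacian_def hX_def hY_def base_apply[symmetric] algebra_simps
        power2_eq_square)
  note G = G_def expand kohn_laplace_def
  \<comment> \<open>From here on, raising one argument of \<open>G\<close> from 0 to 1 isolates the
    coefficient of that jet coordinate.\<close>
  have "G 0 0 0 1 0 0 0 - G 0 0 0 0 0 0 0 = - 2 * hY (f vx) p - 2 * hX (f vy) p"
    unfolding G by (simp add: algebra_simps)
  then show "hY (f vx) p = - hX (f vy) p"
    by (simp add: G0)
  have "G 0 0 0 0 0 1 0 - G 0 0 0 0 0 0 0 = 2 * hX (f vx) p - 2 * hY (f vy) p"
    unfolding G by (simp add: algebra_simps)
  then show "hX (f vx) p = hY (f vy) p"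
    by (simp add: G0)
  have "G 0 0 0 0 1 0 0 - G 0 0 0 0 0 0 0 = 4 * f vy p + 4 * p vy * hX (f vx) p
      + 4 * p vx * hY (f vx) p - 2 * hX (f vt) p"
    unfolding G by (simp add: algebra_simps)
  then show "hX (f vt) p = 2 * f vy p - 2 * p vy * hX (f vx) p + 2 * p vx * hY (f vx) p
       + 4 * p vy * hX (f vx) p"
    by (simp add: G0)
  have "G 0 0 0 0 0 0 1 - G 0 0 0 0 0 0 0 = - 4 * f vx p - 8 * p vx * hX (f vx) p
      - 4 * p vy * hX (f vy) p + 4 * p vx * hY (f vy) p - 2 * hY (f vt) p"
    unfolding G by (simp add: algebra_simps)
  then show "hY (f vt) p = - 2 * f vx p - 2 * p vy * hX (f vy) p + 2 * p vx * hY (f vy) p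
       - 4 * p vx * hX (f vx) p"
    by (simp add: G0)
  have "G 0 1 0 0 0 0 0 - G 0 0 0 0 0 0 0 = 2 * hX \<alpha> p - sublaplacian (f vx) p"
    unfolding G by (simp add: algebra_simps)
  then show "2 * hX \<alpha> p = sublaplacian (f vx) p"
    by (simp add: G0)
  have "G 0 0 1 0 0 0 0 - G 0 0 0 0 0 0 0 = 2 * hY \<alpha> p - sublaplacian (f vy) p"
    unfolding G by (simp add: algebra_simps)
  then show "2 * hY \<alpha> p = sublaplacian (f vy) p"
    by (simp add: G0)
  have "G 0 0 0 0 0 0 0 = sublaplacian \<beta> p + \<beta> p"
    unfolding G by (simp add: algebra_simps)
  then show "sublaplacian \<beta> p + \<beta> p = 0"
    by (simp add: G0)
  have "G 1 0 0 0 0 0 0 - G 0 0 0 0 0 0 0 = sublaplacian \<alpha> p + 2 * hX (f vx) p"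
    unfolding G by (simp add: algebra_simps)
  then show "sublaplacian \<alpha> p + 2 * hX (f vx) p = 0"
    by (simp add: G0)
qed

lemma h_coord:
  "hX (\<lambda>p. p vx) = (\<lambda>p. 1)" "hX (\<lambda>p. p vy) = (\<lambda>p. 0)"
  "hY (\<lambda>p. p vx) = (\<lambda>p. 0)" "hY (\<lambda>p. p vy) = (\<lambda>p. 1)"
  "hX (\<lambda>p. c) = (\<lambda>p. 0)" "hY (\<lambda>p. c) = (\<lambda>p. 0)"
  by (auto simp: hX_def hY_def)

text \<open>\<open>A\<close>, \<open>B\<close>, \<open>C\<close> are the components of \<xi> in the
  frame \<open>X\<close>, \<open>Y\<close>, \<open>\<partial>\<^sub>t\<close>. The equations for
  \<open>C\<close> say that \<xi> preserves the horizontal planes, those for \<open>A\<close> and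
  \<open>B\<close> that it acts on them conformally, with factor \<open>P\<close> and rotation rate
  \<open>Q\<close>.\<close>

lemma conformal_fields_are_isometries:
  fixes A B C :: "point \<Rightarrow> real"
  assumes A: "smooth A" and B: "smooth B" and C: "smooth C" and \<alpha>: "smooth \<alpha>"
    and AB: "\<And>p. hX A p = hY B p" "\<And>p. hY A p = - hX B p"
    and C_eq: "\<And>p. hX C p = 4 * B p" "\<And>p. hY C p = - 4 * A p"
    and \<alpha>_eq: "\<And>p. 2 * hX \<alpha> p = sublaplacian A p" "\<And>p. 2 * hY \<alpha> p = sublaplacian B p"
      "\<And>p. sublaplacian \<alpha> p + 2 * hX A p = 0"
  obtains a0 b0 c0 q e where "\<And>p. A p = a0 - q * p vy" "\<And>p. B p = b0 + q * p vx"
    "\<And>p. C p = c0 + 4 * b0 * p vx - 4 * a0 * p vy + 2 * q * ((p vx)\<^sup>2 + (p vy)\<^sup>2)"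
    "\<And>p. \<alpha> p = e"
proof -
  define P where "P = hX A"
  define Q where "Q = hX B"
  define T where "T = pd vt"
  have P: "smooth P" and Q: "smooth Q"
    unfolding P_def Q_def by (intro smooth_intros A B)+
  note sm = smooth_intros A B C \<alpha> P Q
  have XA: "hX A = P" and XB: "hX B = Q" and YB: "hY B = P" and YA: "hY A = (\<lambda>p. - Q p)"
    using AB by (auto simp: P_def Q_def fun_eq_iff)
  have XC: "hX C = (\<lambda>p. 4 * B p)" and YC: "hY C = (\<lambda>p. - 4 * A p)"
    using C_eq by auto
  have comm: "T f p = (hY (hX f) p - hX (hY f) p) / 4" if "smooth f" for f p
    using hX_hY_commutator[OF that, of p] by (simp add: T_def)
  have TX: "T (hX f) = hX (T f)" and TY: "T (hY f) = hY (T f)" if "smooth f" for f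
    using pd_vt_hX[OF that] pd_vt_hY[OF that] by (simp_all add: T_def)
  have T_cmult: "T (\<lambda>p. c * f p) = (\<lambda>p. c * T f p)" if "smooth f" for c f
    using h_cmult(3)[OF that] by (simp add: T_def)
  have TC: "T C = (\<lambda>p. 2 * P p)"
    using comm[OF C, unfolded XC YC h_cmult[OF A] h_cmult[OF B] XA YB] by (auto simp: fun_eq_iff)
  \<comment> \<open>\<open>T A\<close> and \<open>T B\<close> are computed twice: here from the
    bracket, next by letting the central \<open>T\<close> pass through the equations for
    \<open>C\<close>. The comparison expresses the derivatives of \<open>Q\<close> by those of
    \<open>P\<close>.\<close>
  have TA: "T A p = (hY P p + hX Q p) / 4" and TB: "T B p = (hY Q p - hX P p) / 4" for p
    using comm[OF A, of p, unfolded XA YA h_minus[OF Q]]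
      comm[OF B, of p, unfolded XB YB] by simp_all
  have "T (hX C) = hX (T C)" "T (hY C) = hY (T C)"
    by (simp_all add: TX TY C)
  then have t: "4 * T B p = 2 * hX P p" "- 4 * T A p = 2 * hY P p" for p
    unfolding XC YC TC T_cmult[OF A] T_cmult[OF B] h_cmult[OF P] by (auto dest: fun_cong)
  have t': "T B p = 1/2 * hX P p" "T A p = -1/2 * hY P p" for p
    using t[of p] by linarith+
  have TB': "T B = (\<lambda>p. 1/2 * hX P p)" and TA': "T A = (\<lambda>p. -1/2 * hY P p)"
    by (rule ext, rule t')+
  have q: "hY Q p = 3 * hX P p" "hX Q p = - 3 * hY P p" for p
  proof -
    show "hY Q p = 3 * hX P p"
      using TB[of p] t'(1)[of p] by (simp add: field_simps)
    show "hX Q p = - 3 * hY P p"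
      using TA[of p] t'(2)[of p] by (simp add: field_simps)
  qed
  have YQ: "hY Q = (\<lambda>p. 3 * hX P p)" and XQ: "hX Q = (\<lambda>p. - 3 * hY P p)"
    by (rule ext, rule q)+
  have "T (hX B) = hX (T B)" "T (hY A) = hY (T A)"
    by (simp_all add: TX TY A B)
  moreover have "T (\<lambda>p. - Q p) = (\<lambda>p. - T Q p)"
    using T_cmult[OF Q, of "-1"] by simp
  ultimately have "T Q = (\<lambda>p. 1/2 * hX (hX P) p)" "(\<lambda>p. - T Q p) = (\<lambda>p. -1/2 * hY (hY P) p)"
    unfolding XB YA TA' TB' h_cmult[OF smooth_hX[OF P]] h_cmult[OF smooth_hY[OF P]] by auto
  then have TQ: "T Q p = 1/2 * hX (hX P) p" "T Q p = 1/2 * hY (hY P) p" for p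
    by (auto dest: fun_cong[of _ _ p])
  \<comment> \<open>The third value of \<open>T Q\<close>. With \<open>s\<close> the common value of
    \<open>hX (hX P)\<close> and \<open>hY (hY P)\<close>, the three give
    \<open>s / 2 = - 3 * s / 2\<close>.\<close>
  have TQ': "- 4 * T Q p = 3 * hX (hX P) p + 3 * hY (hY P) p" for p
    using comm[OF Q, of p] unfolding XQ YQ h_cmult[OF smooth_hX[OF P]] h_cmult[OF smooth_hY[OF P]]
    by simp
  have XXP: "hX (hX P) p = 0" for p
    using TQ[of p] TQ'[of p] by linarith
  have YYP: "hY (hY P) p = 0" for p
    using TQ[of p] TQ'[of p] by linarith
  \<comment> \<open>The horizontal gradients of \<alpha> and \<open>- P\<close> agree, so \<alpha>
    is harmonic too; the zeroth order equation then forces \<open>P = 0\<close>.\<close>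
  have "hX \<alpha> = (\<lambda>p. - 1 * hX P p)" "hY \<alpha> = (\<lambda>p. - 1 * hY P p)"
    using \<alpha>_eq(1,2) by (auto simp: sublaplacian_eq A B XA XB YA YB h_minus Q XQ YQ fun_eq_iff)
  then have "sublaplacian \<alpha> p = 0" for p
    unfolding sublaplacian_eq[OF \<alpha>] by (simp only: h_cmult sm XXP YYP)
  then have P0: "P = (\<lambda>p. 0)"
    using \<alpha>_eq(3) by (auto simp: XA)
  have Q_const: "Q p = Q (\<lambda>_. 0)" for p
    by (rule constant_if_horizontally_constant[OF Q]) (simp_all add: XQ YQ P0 h_coord)
  define q where "q = Q (\<lambda>_. 0)"
  have Qq: "Q = (\<lambda>p. q)"
    using Q_const by (auto simp: q_def)
  have 1: "\<alpha> p = \<alpha> (\<lambda>_. 0)" for p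
    by (rule constant_if_horizontally_constant[OF \<alpha>])
      (use \<alpha>_eq(1,2) in \<open>auto simp: sublaplacian_eq A B XA XB YA YB P0 Qq h_coord\<close>)
  have A_const: "A p + q * p vy = A (\<lambda>_. 0) + q * (\<lambda>_. 0) vy" for p
    by (rule constant_if_horizontally_constant[of "\<lambda>p. A p + q * p vy"])
      (simp_all add: sm h_simps h_coord XA YA P0 Qq)
  have B_const: "B p - q * p vx = B (\<lambda>_. 0) - q * (\<lambda>_. 0) vx" for p
    by (rule constant_if_horizontally_constant[of "\<lambda>p. B p - q * p vx"])
      (simp_all add: sm h_simps h_coord XB YB P0 Qq)
  define a0 b0 where "a0 = A (\<lambda>_. 0)" and "b0 = B (\<lambda>_. 0)"
  have A': "A p = a0 - q * p vy" and B': "B p = b0 + q * p vx" for p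
    unfolding a0_def b0_def using A_const[of p] B_const[of p] by simp_all
  \<comment> \<open>The candidate for \<open>C\<close> minus its constant is subtracted. Squares are
    written as products so that the product rules in \<open>h_simps\<close> apply.\<close>
  let ?h = "\<lambda>p. C p - (4 * b0 * p vx - 4 * a0 * p vy + 2 * q * (p vx * p vx + p vy * p vy))"
  have C_const: "?h p = ?h (\<lambda>_. 0)" for p
    by (rule constant_if_horizontally_constant[of ?h])
      (simp_all add: sm h_simps h_coord XC YC A' B' algebra_simps)
  have "C p = C (\<lambda>_. 0) + 4 * b0 * p vx - 4 * a0 * p vy + 2 * q * ((p vx)\<^sup>2 + (p vy)\<^sup>2)" for p
    using C_const[of p] by (simp add: algebra_simps power2_eq_square)
  from that[OF A' B' this 1] show ?thesis .
qed

lemma lie_point_symmetry_classification: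
  assumes S: "lie_point_symmetry S"
  obtains a b c d e \<beta> where "solution \<beta>"
    "S = VField (\<lambda>i z. case i of vx \<Rightarrow> c + b * cy z | vy \<Rightarrow> d - b * cx z | vt \<Rightarrow> a - 2 * c * cy z + 2 * d * cx z)
      (\<lambda>z. e * uu z + \<beta> (base z))"
proof -
  obtain f \<alpha> \<beta> where f: "\<And>k. smooth (f k)" and \<alpha>: "smooth \<alpha>" and \<beta>: "smooth \<beta>"
    and eq: "S = VField (\<lambda>k z. f k (base z)) (\<lambda>z. \<alpha> (base z) * uu z + \<beta> (base z))"
    by (rule lie_point_symmetry_affine[OF S], rule that)
  note E = affine_symmetry_equations[OF S[unfolded eq] f \<alpha> \<beta>]
  \<comment> \<open>The \<open>\<partial>\<^sub>t\<close> component of \<xi> in the horizontal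
    frame.\<close>
  let ?C = "\<lambda>p. f vt p - 2 * (p vy * f vx p) + 2 * (p vx * f vy p)"
  note sm = smooth_intros f
  have C: "smooth ?C"
    by (intro sm)
  have C_eq: "hX ?C p = 4 * f vy p" "hY ?C p = - 4 * f vx p" for p
    using E(1-4)[of p] by (simp_all add: sm h_simps h_coord algebra_simps)
  obtain a0 b0 c0 q e where *: "\<And>p. f vx p = a0 - q * p vy" "\<And>p. f vy p = b0 + q * p vx"
    "\<And>p. ?C p = c0 + 4 * b0 * p vx - 4 * a0 * p vy + 2 * q * ((p vx)\<^sup>2 + (p vy)\<^sup>2)"
    "\<And>p. \<alpha> p = e"
    by (rule conformal_fields_are_isometries[OF f f C \<alpha> E(1,2) C_eq E(5,6,7)], rule that)
  have vt: "f vt p = c0 - 2 * a0 * p vy + 2 * b0 * p vx" for p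
    using *(3)[of p] unfolding *(1,2) by (simp add: algebra_simps power2_eq_square)
  show ?thesis
  proof (rule that)
    show "solution \<beta>"
      using \<beta> E(8) by (simp add: solution_iff)
    \<comment> \<open>The sign of \<open>q\<close> is reversed because \<open>symR\<close> rotates
      with components \<open>y\<close> and \<open>-x\<close>.\<close>
    show "S = VField (\<lambda>i z. case i of vx \<Rightarrow> a0 + - q * cy z | vy \<Rightarrow> b0 - - q * cx z
        | vt \<Rightarrow> c0 - 2 * a0 * cy z + 2 * b0 * cx z) (\<lambda>z. e * uu z + \<beta> (base z))"
      unfolding eq by (auto simp: fun_eq_iff *(1,2,4) vt base_def split: var.split)
  qed
qed

subsection \<open>Divergences of test functions\<close>

text \<open>The chain rule for a curve moving finitely many coordinates, by induction on their
  number. Each step splits off one coordinate and uses the criterion for functions of two variables,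
  where only the partial derivative in the split coordinate has to be jointly continuous.\<close>

lemma has_derivative_along_curve:
  assumes "finite C" and F: "smooth F"
    and "\<And>c s. c \<in> C \<Longrightarrow> ((\<lambda>s. \<gamma> s c) has_real_derivative \<gamma>' s c) (at s)"
    and "\<And>c s s'. c \<notin> C \<Longrightarrow> \<gamma> s c = \<gamma> s' c"
  shows "((\<lambda>s. F (\<gamma> s)) has_real_derivative (\<Sum>c\<in>C. pd c F (\<gamma> s) * \<gamma>' s c)) (at s)"
  using assms(1,3,4)
proof (induction C arbitrary: \<gamma> rule: finite_induct)
  case empty
  have "\<gamma> s' = \<gamma> s" for s'
    using empty(2) by blast
  then have "(\<lambda>s. F (\<gamma> s)) = (\<lambda>s'. F (\<gamma> s))"
    by metis
  then show ?case
    by simp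
next
  case (insert c C)
  \<comment> \<open>The same curve with coordinate \<open>c\<close> frozen at its value at
    \<open>s\<close>.\<close>
  define \<eta> where "\<eta> r = (\<gamma> r)(c := \<gamma> s c)" for r
  have [simp]: "\<eta> s = \<gamma> s" "(\<eta> r)(c := \<gamma> s c) = \<eta> r" "(\<eta> r)(c := \<gamma> r c) = \<gamma> r" for r
    by (auto simp: \<eta>_def)
  have \<eta>: "((\<lambda>r. \<eta> r d) has_real_derivative \<gamma>' r d) (at r)" if "d \<in> C" for d r
  proof -
    have "d \<noteq> c"
      using that insert.hyps by blast
    then show ?thesis
      using that insert.prems(1)[of d r] by (simp add: \<eta>_def)
  qed
  have \<eta>_const: "\<eta> r d = \<eta> r' d" if "d \<notin> C" for d r r'
    using that insert.prems(2)[of d r r'] by (auto simp: \<eta>_def)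
  have "((\<lambda>r. F (\<eta> r)) has_real_derivative (\<Sum>d\<in>C. pd d F (\<eta> s) * \<gamma>' s d)) (at s)"
    by (rule insert.IH) (fact \<eta> \<eta>_const)+
  then have fx: "((\<lambda>r. F ((\<eta> r)(c := \<gamma> s c))) has_derivative
      (*) (\<Sum>d\<in>C. pd d F (\<gamma> s) * \<gamma>' s d)) (at s within UNIV)"
    by (simp add: has_field_derivative_def del: fun_upd_apply)
  have fy: "((\<lambda>b. F ((\<eta> r)(c := b))) has_derivative
      blinfun_apply (blinfun_mult_right (pd c F ((\<eta> r)(c := b))))) (at b within UNIV)" for r b
    using has_derivative_pd[OF smooth_partially_differentiable[OF F], of "\<eta> r" c b]
    by (simp add: has_field_derivative_def del: fun_upd_apply)
  have "continuous_on UNIV (\<lambda>(r, b). (\<eta> r)(c := b))"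
  proof (rule continuous_on_coordinatewise_then_product)
    fix d
    have "continuous_on UNIV (\<lambda>r. \<eta> r d)"
    proof (cases "d \<in> C")
      case True
      then show ?thesis
        by (intro DERIV_continuous_on[of _ _ "\<lambda>r. \<gamma>' r d"]) (simp add: \<eta>)
    next
      case False
      then have "(\<lambda>r. \<eta> r d) = (\<lambda>r. \<eta> s d)"
        using \<eta>_const by blast
      then show ?thesis
        by (simp only: continuous_on_const)
    qed
    then have "continuous_on UNIV (\<lambda>q::real \<times> real. \<eta> (fst q) d)"
      by (rule continuous_on_compose2) (auto intro!: continuous_intros)
    then show "continuous_on UNIV (\<lambda>q. (case q of (r, b) \<Rightarrow> (\<eta> r)(c := b)) d)"
      by (cases "d = c") (auto simp: split_beta' intro!: continuous_intros)
  qed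
  then have "continuous_on UNIV (\<lambda>q. pd c F ((\<lambda>(r, b). (\<eta> r)(c := b)) q))"
    by (rule continuous_on_compose2[OF smooth_continuous[OF smooth_pd[OF F]]]) auto
  then have "continuous_on UNIV (\<lambda>q. blinfun_mult_right (pd c F ((\<lambda>(r, b). (\<eta> r)(c := b)) q)))"
    by (rule bounded_linear.continuous_on[OF bounded_linear_blinfun_mult_right])
  then have fy_cont: "continuous (at (s, \<gamma> s c) within UNIV \<times> UNIV)
      (\<lambda>(r, b). blinfun_mult_right (pd c F ((\<eta> r)(c := b))))"
    by (simp add: continuous_on_eq_continuous_at split_beta')
  have "((\<lambda>(r, b). F ((\<eta> r)(c := b))) has_derivative
      (\<lambda>(h, k). (\<Sum>d\<in>C. pd d F (\<gamma> s) * \<gamma>' s d) * h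
        + blinfun_mult_right (pd c F ((\<eta> s)(c := \<gamma> s c))) k)) (at (s, \<gamma> s c) within UNIV \<times> UNIV)"
    by (rule has_derivative_partialsI[OF fx fy fy_cont]) auto
  then have g: "((\<lambda>q. F ((\<eta> (fst q))(c := snd q))) has_derivative
      (\<lambda>q. (\<Sum>d\<in>C. pd d F (\<gamma> s) * \<gamma>' s d) * fst q + pd c F (\<gamma> s) * snd q)) (at (s, \<gamma> s c))"
    by (simp add: split_beta' del: fun_upd_apply)
  have "((\<lambda>r. (r, \<gamma> r c)) has_derivative (\<lambda>h. (h, \<gamma>' s c * h))) (at s)"
    using insert.prems(1)[of c s]
    by (auto simp: has_field_derivative_def intro!: derivative_eq_intros)
  from has_derivative_compose[OF this g]
  have "((\<lambda>r. F (\<gamma> r)) has_derivative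
      (\<lambda>h. (\<Sum>d\<in>C. pd d F (\<gamma> s) * \<gamma>' s d) * h + pd c F (\<gamma> s) * (\<gamma>' s c * h))) (at s)"
    by (simp del: fun_upd_apply)
  then show ?case
    unfolding has_field_derivative_def
    by (rule has_derivative_eq_rhs) (use insert.hyps in \<open>simp add: fun_eq_iff algebra_simps\<close>)
qed

text \<open>The hypotheses on \<open>w\<close> are the contact conditions met by a prolonged
  function as the base point moves in direction \<open>i\<close>; the chain rule along such a curve
  is the total derivative.\<close>

lemma has_derivative_D:
  assumes "differential_function F"
    and Base: "\<And>j s. ((\<lambda>s. w s (Base j)) has_real_derivative (if i = j then 1 else 0)) (at s)"
    and Jet: "\<And>\<alpha> s. ((\<lambda>s. w s (Jet \<alpha>)) has_real_derivative w s (Jet (add_mset i \<alpha>))) (at s)"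
  shows "((\<lambda>s. F (w s)) has_real_derivative D i F (w s)) (at s)"
proof -
  obtain C where F: "smooth F" and C: "finite C" "depends_on C F"
    using assms(1) unfolding differential_function_def by blast
  define K where "K = Jet -` C"
  have K: "finite K"
    unfolding K_def by (rule finite_vimageI[OF C(1)]) (simp add: inj_def)
  have pd0: "pd (Jet \<alpha>) F z = 0" if "\<alpha> \<notin> K" for \<alpha> z
    using that pd_eq_0_if_depends_on[OF C(2)] by (simp add: K_def)
  define C' where "C' = range Base \<union> Jet ` K"
  have "c \<in> C'" if "c \<in> C" for c
    using that by (cases c) (auto simp: C'_def K_def)
  then have C': "finite C'" "C \<subseteq> C'"
    using K finite_range_Base by (auto simp: C'_def)
  define w' where "w' r c = (case c of Base j \<Rightarrow> if i = j then 1 else 0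
      | Jet \<alpha> \<Rightarrow> w r (Jet (add_mset i \<alpha>)))" for r c
  \<comment> \<open>Freezing the coordinates outside \<open>C'\<close> leaves finitely many moving
    ones, and neither \<open>F\<close> nor its partial derivatives notice.\<close>
  define \<gamma> where "\<gamma> r c = (if c \<in> C' then w r c else 0)" for r c
  have F\<gamma>: "G (\<gamma> r) = G (w r)" if "depends_on C G" for G r
  proof -
    have "\<forall>c\<in>C. \<gamma> r c = w r c"
      using C'(2) by (auto simp: \<gamma>_def)
    then show ?thesis
      using that unfolding depends_on_def by blast
  qed
  have "((\<lambda>r. F (\<gamma> r)) has_real_derivative (\<Sum>c\<in>C'. pd c F (\<gamma> s) * w' s c)) (at s)"
  proof (rule has_derivative_along_curve[OF C'(1) F])
    fix c r
    assume "c \<in> C'"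
    then show "((\<lambda>s. \<gamma> s c) has_real_derivative w' r c) (at r)"
      using Base Jet by (cases c) (auto simp: \<gamma>_def w'_def)
  qed (simp add: \<gamma>_def)
  also have "(\<Sum>c\<in>C'. pd c F (\<gamma> s) * w' s c) = (\<Sum>c\<in>C'. pd c F (w s) * w' s c)"
    by (simp add: F\<gamma>[OF depends_on_pd[OF C(2)]])
  also have "\<dots> = (\<Sum>c\<in>range Base. pd c F (w s) * w' s c) + (\<Sum>c\<in>Jet ` K. pd c F (w s) * w' s c)"
    unfolding C'_def by (rule sum.union_disjoint) (use K finite_range_Base in auto)
  also have "(\<Sum>c\<in>range Base. pd c F (w s) * w' s c) = (\<Sum>j\<in>UNIV. pd (Base j) F (w s) * w' s (Base j))"
    by (subst sum.reindex) (auto simp: inj_def)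
  also have "\<dots> = pd (Base i) F (w s)"
    by (simp add: w'_def if_distrib cong: if_cong)
  also have "(\<Sum>c\<in>Jet ` K. pd c F (w s) * w' s c) = (\<Sum>\<alpha>\<in>K. pd (Jet \<alpha>) F (w s) * w' s (Jet \<alpha>))"
    by (subst sum.reindex) (auto simp: inj_on_def)
  also have "pd (Base i) F (w s) + \<dots> = D i F (w s)"
    by (simp add: D_eq[OF K pd0] w'_def mult.commute)
  finally show ?thesis
    by (simp add: F\<gamma>[OF C(2)])
qed

lemma continuous_on_D:
  assumes "differential_function F"
  shows "continuous_on UNIV (D i F)"
proof -
  have F: "smooth F" "finitary F"
    using assms smooth_partially_differentiable
    by (auto simp: differential_function_def finitary_def)
  obtain K where K: "finite K" "\<And>\<alpha>. \<alpha> \<notin> K \<Longrightarrow> pd (Jet \<alpha>) F = (\<lambda>z. 0)"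
    using finitary_finite_jets[OF F(2)] by blast
  have "D i F = (\<lambda>z. pd (Base i) F z + (\<Sum>\<alpha>\<in>K. z (Jet (add_mset i \<alpha>)) * pd (Jet \<alpha>) F z))"
    by (rule ext, rule D_eq) (use K in auto)
  then show ?thesis
    by (auto intro!: continuous_on_add continuous_on_sum continuous_on_mult
        continuous_on_product_coordinates smooth_continuous[OF smooth_pd[OF F(1)]])
qed

text \<open>The jet at \<open>p\<close> of the test function \<open>g x * g y * g t\<close>.\<close>

definition product_jet :: "real poly \<Rightarrow> point \<Rightarrow> jetpoint" where
  "product_jet g p c = (case c of Base j \<Rightarrow> p j
     | Jet \<alpha> \<Rightarrow> (\<Prod>j\<in>UNIV. poly ((pderiv ^^ count \<alpha> j) g) (p j)))"

lemma product_jet_simps [simp]: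
  "product_jet g p (Base j) = p j"
  "product_jet g p (Jet \<alpha>) = (\<Prod>j\<in>UNIV. poly ((pderiv ^^ count \<alpha> j) g) (p j))"
  by (simp_all add: product_jet_def)

lemma continuous_on_product_jet: "continuous_on UNIV (product_jet g)"
proof (rule continuous_on_coordinatewise_then_product)
  show "continuous_on UNIV (\<lambda>p. product_jet g p c)" for c
    by (cases c) (auto intro!: continuous_intros continuous_on_product_coordinates)
qed

lemma has_derivative_D_product_jet:
  assumes "differential_function F"
  shows "((\<lambda>s. F (product_jet g (p(i := s)))) has_real_derivative
    D i F (product_jet g (p(i := s)))) (at s)"
proof (rule has_derivative_D[OF assms])
  show "((\<lambda>s. product_jet g (p(i := s)) (Base j)) has_real_derivative (if i = j then 1 else 0)) (at s)"
    for j s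
    by auto
  fix \<alpha> :: "var multiset" and s
  define q where "q j = (pderiv ^^ count \<alpha> j) g" for j
  have split: "(\<Prod>j\<in>UNIV. poly (r j) ((p(i := s)) j)) = poly (r i) s * (\<Prod>j\<in>UNIV - {i}. poly (r j) (p j))"
    for r :: "var \<Rightarrow> real poly" and s
    by (subst prod.remove[of UNIV i]) (auto intro!: prod.cong)
  have "product_jet g (p(i := s)) (Jet \<alpha>) = poly (q i) s * (\<Prod>j\<in>UNIV - {i}. poly (q j) (p j))" for s
    unfolding product_jet_simps q_def[symmetric] by (rule split)
  moreover have "product_jet g (p(i := s)) (Jet (add_mset i \<alpha>)) =
      poly (pderiv (q i)) s * (\<Prod>j\<in>UNIV - {i}. poly (q j) (p j))"
    unfolding product_jet_simps split by (auto simp: q_def intro!: prod.cong)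
  ultimately show "((\<lambda>s. product_jet g (p(i := s)) (Jet \<alpha>)) has_real_derivative
      product_jet g (p(i := s)) (Jet (add_mset i \<alpha>))) (at s)"
    by (simp only:) (rule DERIV_cmult_right[OF poly_DERIV])
qed

text \<open>Each derivative lowers the power of \<open>q\<close> that divides the polynomial by at
  most one.\<close>

lemma poly_higher_pderiv_eq_0:
  fixes q :: "'a :: {comm_semiring_1, semiring_no_zero_divisors} poly"
  assumes "poly q x = 0" "k < n"
  shows "poly ((pderiv ^^ k) (q ^ n)) x = 0"
proof -
  have "q ^ (n - k) dvd (pderiv ^^ k) (q ^ n)" if "k \<le> n" for k
    using that
  proof (induction k)
    case (Suc k)
    then obtain r where r: "(pderiv ^^ k) (q ^ n) = q ^ Suc (n - Suc k) * r"
      by (metis Suc_diff_Suc Suc_leD Suc_le_lessD dvdE)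
    show ?case
      unfolding funpow.simps comp_apply r pderiv_mult pderiv_power_Suc
      by (intro dvd_add) (simp_all add: dvd_smult dvd_mult)
  qed simp
  from this[of k] obtain r where "(pderiv ^^ k) (q ^ n) = q ^ (n - k) * r"
    using assms(2) by (auto elim: dvdE)
  then show ?thesis
    using assms by (simp add: power_0_left)
qed


section \<open>Iterated integrals over the unit cube\<close>

definition pt :: "real \<Rightarrow> real \<Rightarrow> real \<Rightarrow> point" where
  "pt x y t = (\<lambda>i. case i of vx \<Rightarrow> x | vy \<Rightarrow> y | vt \<Rightarrow> t)"

lemma pt_simps [simp]: "pt x y t vx = x" "pt x y t vy = y" "pt x y t vt = t"
  by (simp_all add: pt_def)

lemma pt_upd:
  "(pt x y t)(vx := s) = pt s y t" "(pt x y t)(vy := s) = pt x s t" "(pt x y t)(vt := s) = pt x y s"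
  by (auto simp: pt_def split: var.split)

lemma continuous_on_pt:
  assumes h: "continuous_on UNIV h" and "continuous_on S a" "continuous_on S b" "continuous_on S c"
  shows "continuous_on S (\<lambda>q. h (pt (a q) (b q) (c q)))"
proof (rule continuous_on_compose2[OF h])
  show "continuous_on S (\<lambda>q. pt (a q) (b q) (c q))"
  proof (rule continuous_on_coordinatewise_then_product)
    show "continuous_on S (\<lambda>q. pt (a q) (b q) (c q) i)" for i
      using assms(2-) by (cases i) auto
  qed
qed auto

lemma continuous_on_integral_pt:
  fixes h :: "point \<Rightarrow> real"
  assumes h: "continuous_on UNIV h"
  shows "continuous_on S (\<lambda>(y, t). integral {0..1} (\<lambda>x. h (pt x y t)))"
    and "continuous_on S' (\<lambda>t. integral {0..1} (\<lambda>y. integral {0..1} (\<lambda>x. h (pt x y t))))"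
proof -
  have *: "continuous_on S (\<lambda>q::real \<times> real. integral (cbox 0 1) (\<lambda>x. h (pt x (fst q) (snd q))))" for S
    using integral_continuous_on_param[of S 0 1 "\<lambda>q x. h (pt x (fst q) (snd q))"]
    by (simp add: split_beta' continuous_on_pt[OF h] continuous_intros)
  then show "continuous_on S (\<lambda>(y, t). integral {0..1} (\<lambda>x. h (pt x y t)))"
    by (simp add: split_beta')
  have "continuous_on (S' \<times> cbox 0 1) (\<lambda>(t, y). integral (cbox 0 1) (\<lambda>x. h (pt x y t)))"
    using continuous_on_compose2[OF *[of UNIV], of "S' \<times> cbox 0 1" "\<lambda>q. (snd q, fst q)"]
    by (simp add: split_beta' continuous_intros)
  from integral_continuous_on_param[OF this]
  show "continuous_on S' (\<lambda>t. integral {0..1} (\<lambda>y. integral {0..1} (\<lambda>x. h (pt x y t))))"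
    by simp
qed

text \<open>A continuous nonnegative function on an interval with integral zero vanishes; this is
  applied to the outer, middle and inner integral in turn.\<close>

lemma nonneg_eq_0_if_iterated_integral_eq_0:
  fixes h :: "point \<Rightarrow> real"
  assumes h: "continuous_on UNIV h"
    and nonneg: "\<And>x y t. x \<in> {0..1} \<Longrightarrow> y \<in> {0..1} \<Longrightarrow> t \<in> {0..1} \<Longrightarrow> h (pt x y t) \<ge> 0"
    and int0: "integral {0..1} (\<lambda>t. integral {0..1} (\<lambda>y. integral {0..1} (\<lambda>x. h (pt x y t)))) = 0"
    and "x \<in> {0..1}" "y \<in> {0..1}" "t \<in> {0..1}"
  shows "h (pt x y t) = 0"
proof -
  define J where "J y t = integral {0..1} (\<lambda>x. h (pt x y t))" for y t
  define I where "I t = integral {0..1} (\<lambda>y. J y t)" for t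
  have cont_x: "continuous_on {0..1} (\<lambda>x. h (pt x y t))" for y t
    by (intro continuous_on_pt[OF h] continuous_intros)
  have "continuous_on UNIV (\<lambda>q. J (fst q) (snd q))"
    using continuous_on_integral_pt(1)[OF h, of UNIV] by (simp add: J_def split_beta')
  note J_cont = continuous_on_compose2[OF this _ subset_UNIV]
  have cont_y: "continuous_on {0..1} (\<lambda>y. J y t)" for t
    using J_cont[of "{0..1}" "\<lambda>y. (y, t)"] by (simp add: continuous_intros)
  have cont_t: "continuous_on {0..1} I"
    using continuous_on_integral_pt(2)[OF h] by (simp add: I_def[abs_def] J_def)
  have J: "J y t \<ge> 0" if "y \<in> {0..1}" "t \<in> {0..1}" for y t
    unfolding J_def by (rule integral_nonneg) (use that in \<open>auto intro!: nonneg integrable_continuous_real cont_x\<close>)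
  have I: "I t \<ge> 0" if "t \<in> {0..1}" for t
    unfolding I_def by (rule integral_nonneg) (use that in \<open>auto intro!: J integrable_continuous_real cont_y\<close>)
  have "I t = 0"
    using integral_eq_0_iff[of 0 1 I] cont_t I assms(6) int0[folded J_def, folded I_def] by simp
  then have "J y t = 0"
    using integral_eq_0_iff[of 0 1 "\<lambda>y. J y t"] cont_y J assms(5,6) by (simp add: I_def)
  then show ?thesis
    using integral_eq_0_iff[of 0 1 "\<lambda>x. h (pt x y t)"] cont_x nonneg assms(4-6) by (simp add: J_def)
qed

text \<open>Fubini's theorem moves the direction of each component to the innermost place, where its
  integral is zero: no swap for \<open>vx\<close>, one for \<open>vy\<close>, two for
  \<open>vt\<close>.\<close>

lemma iterated_integral_eq_0:
  fixes h :: "var \<Rightarrow> point \<Rightarrow> real"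
  assumes cont: "\<And>i. continuous_on UNIV (h i)"
    and int0: "\<And>i p. integral {0..1} (\<lambda>s. h i (p(i := s))) = 0"
  shows "integral {0..1} (\<lambda>t. integral {0..1} (\<lambda>y. integral {0..1} (\<lambda>x.
    \<Sum>i\<in>UNIV. h i (pt x y t)))) = 0"
proof -
  have int: "integral {0..1} (\<lambda>x. h vx (pt x y t)) = 0" "integral {0..1} (\<lambda>y. h vy (pt x y t)) = 0"
    "integral {0..1} (\<lambda>t. h vt (pt x y t)) = 0" for x y t
    using int0[of vx "pt x y t"] int0[of vy "pt x y t"] int0[of vt "pt x y t"] by (simp_all add: pt_upd)
  define J where "J i y t = integral {0..1} (\<lambda>x. h i (pt x y t))" for i y t
  define I where "I i t = integral {0..1} (\<lambda>y. J i y t)" for i t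
  have int_x: "(\<lambda>x. h i (pt x y t)) integrable_on {0..1}" for i y t
    by (intro integrable_continuous_real continuous_on_pt[OF cont] continuous_intros)
  have "continuous_on UNIV (\<lambda>q. J i (fst q) (snd q))" for i
    using continuous_on_integral_pt(1)[OF cont, of UNIV] by (simp add: J_def split_beta')
  note J_cont = continuous_on_compose2[OF this _ subset_UNIV]
  have int_y: "(\<lambda>y. J i y t) integrable_on {0..1}" for i t
    using J_cont[of "{0..1}" "\<lambda>y. (y, t)" i]
    by (intro integrable_continuous_real) (simp add: continuous_intros)
  have swap_xy: "integral {0..1} (\<lambda>y. integral {0..1} (\<lambda>x. h i (pt x y t))) =
      integral {0..1} (\<lambda>x. integral {0..1} (\<lambda>y. h i (pt x y t)))" for i t
    using integral_swap_continuous[of 0 0 1 1 "\<lambda>y x. h i (pt x y t)"]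
    by (simp add: split_beta' continuous_on_pt[OF cont] continuous_intros)
  have swap_xt: "integral {0..1} (\<lambda>t. integral {0..1} (\<lambda>x. h i (pt x y t))) =
      integral {0..1} (\<lambda>x. integral {0..1} (\<lambda>t. h i (pt x y t)))" for i y
    using integral_swap_continuous[of 0 0 1 1 "\<lambda>t x. h i (pt x y t)"]
    by (simp add: split_beta' continuous_on_pt[OF cont] continuous_intros)
  have swap_yt: "integral {0..1} (\<lambda>t. integral {0..1} (\<lambda>y. J i y t)) =
      integral {0..1} (\<lambda>y. integral {0..1} (\<lambda>t. J i y t))" for i
    using integral_swap_continuous[of 0 0 1 1 "\<lambda>t y. J i y t"]
      J_cont[of "cbox (0, 0) (1, 1)" "\<lambda>q. (snd q, fst q)" i]
    by (simp add: split_beta' continuous_intros)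
  have "integral {0..1} (\<lambda>x. \<Sum>i\<in>UNIV. h i (pt x y t)) = J vy y t + J vt y t" for y t
    by (simp add: sum_UNIV_var integral_add integrable_add int_x int J_def)
  moreover have "integral {0..1} (\<lambda>y. J vy y t + J vt y t) = I vt t" for t
    using swap_xy[of vy t] by (simp add: integral_add int_y I_def int) (simp add: J_def int)
  moreover have "integral {0..1} (I vt) = 0"
    using swap_yt[of vt] swap_xt[of vt] by (simp add: I_def[abs_def]) (simp add: J_def int)
  ultimately show ?thesis
    by simp
qed

section \<open>Exclusion of the scaling field\<close>

text \<open>The polynomial \<open>s - s^2\<close> vanishes at 0 and 1, so the factor in direction
  \<open>i\<close> of any jet of order below \<open>n\<close> is zero on that face.\<close>

lemma product_jet_vanish_on_boundary:
  assumes "p i \<in> {0, 1}" "size \<alpha> < n"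
  shows "product_jet ([:0, 1, -1:] ^ n) p (Jet \<alpha>) = 0"
proof -
  have "poly ((pderiv ^^ count \<alpha> i) ([:0, 1, -1:] ^ n)) (p i) = 0"
    by (rule poly_higher_pderiv_eq_0)
      (use assms count_le_size[of \<alpha> i] in \<open>auto simp: le_less_trans\<close>)
  then show ?thesis
    by (auto simp: prod_zero_iff)
qed

text \<open>A divergence integrates over the cube to boundary values of \<psi>, which are the same
  for the test function and for zero; the sum of squares, however, is positive somewhere for the
  test function.\<close>

lemma Div_squares_trivial:
  assumes \<psi>: "\<And>i. differential_function (\<psi> i)"
    and Div: "\<And>z. Div \<psi> z = c * ((ux z + 2 * cy z * ut z - (1 - 2 * cx z) * uu z)\<^sup>2
      + (uy z - 2 * cx z * ut z)\<^sup>2 + 4 * cx z * (1 - cx z) * (uu z)\<^sup>2)"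
  shows "c = 0"
proof (rule ccontr)
  assume "c \<noteq> 0"
  have "\<forall>i. \<exists>C. finite C \<and> depends_on C (\<psi> i)"
    using \<psi> by (simp add: differential_function_def)
  then obtain C where C: "\<And>i. finite (C i)" "\<And>i. depends_on (C i) (\<psi> i)"
    by metis
  define K where "K = Jet -` (\<Union>i. C i)"
  have "finite K"
    unfolding K_def by (rule finite_vimageI) (use C(1) in \<open>auto simp: inj_def\<close>)
  \<comment> \<open>Larger than the order of every jet that \<psi> depends on; the inserted 0 covers
    the case of no jets.\<close>
  define n where "n = Suc (Max (insert 0 (size ` K)))"
  have n: "size \<alpha> < n" if "\<alpha> \<in> K" for \<alpha>
    unfolding n_def less_Suc_eq_le by (rule Max_ge) (use \<open>finite K\<close> that in auto)
  define g :: "real poly" where "g = [:0, 1, -1:] ^ n"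
  define w where "w = product_jet g"
  \<comment> \<open>The jet of the zero function. \<psi> need not vanish on it, so it is the
    reference to be subtracted.\<close>
  define w0 where "w0 = product_jet 0"
  have pderiv_0: "(pderiv ^^ k) 0 = (0 :: real poly)" for k
    by (induction k) auto
  have w0_Jet: "w0 p (Jet \<alpha>) = 0" for p \<alpha>
    by (simp add: w0_def pderiv_0 UNIV_var)
  have boundary: "\<psi> j (w p) = \<psi> j (w0 p)" if "p i \<in> {0, 1}" for p i j
  proof -
    have "w p c = w0 p c" if "c \<in> C j" for c
    proof (cases c)
      case (Base k)
      then show ?thesis by (simp add: w_def w0_def)
    next
      case (Jet \<alpha>)
      then have "size \<alpha> < n"
        using that by (intro n) (auto simp: K_def)
      then show ?thesis
        using product_jet_vanish_on_boundary[of p i, OF \<open>p i \<in> {0, 1}\<close>] w0_Jet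
        unfolding Jet w_def g_def by simp
    qed
    then show ?thesis
      using C(2)[of j] unfolding depends_on_def by blast
  qed
  \<comment> \<open>Dividing by \<open>c\<close> makes the sum of the \<open>h i\<close> nonnegative
    on the cube whatever the sign of \<open>c\<close>.\<close>
  define h where "h i p = (D i (\<psi> i) (w p) - D i (\<psi> i) (w0 p)) / c" for i p
  have cont: "continuous_on UNIV (h i)" for i
    unfolding h_def w_def w0_def
    by (intro continuous_intros continuous_on_compose2[OF continuous_on_D[OF \<psi>]]
        continuous_on_product_jet) (use \<open>c \<noteq> 0\<close> in auto)
  have int0: "integral {0..1} (\<lambda>s. h i (p(i := s))) = 0" for i p
  proof -
    have "((\<lambda>s. (\<psi> i (w (p(i := s))) - \<psi> i (w0 (p(i := s)))) / c) has_real_derivative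
        h i (p(i := s))) (at s)" for s
      unfolding h_def w_def w0_def
      by (intro DERIV_cdivide DERIV_diff has_derivative_D_product_jet \<psi>)
    then have "((\<lambda>s. h i (p(i := s))) has_integral
        (\<psi> i (w (p(i := 1))) - \<psi> i (w0 (p(i := 1)))) / c
        - (\<psi> i (w (p(i := 0))) - \<psi> i (w0 (p(i := 0)))) / c) {0..1}"
      by (intro fundamental_theorem_of_calculus)
        (auto simp: has_real_derivative_iff_has_vector_derivative[symmetric] simp del: fun_upd_apply
          intro: has_field_derivative_at_within)
    then show ?thesis
      using boundary[of "p(i := 1)" i i] boundary[of "p(i := 0)" i i] by (simp add: integral_unique)
  qed
  define E where "E p = (\<Sum>i\<in>UNIV. h i p)" for p
  have E: "E p = (ux (w p) + 2 * p vy * ut (w p) - (1 - 2 * p vx) * uu (w p))\<^sup>2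
      + (uy (w p) - 2 * p vx * ut (w p))\<^sup>2 + 4 * p vx * (1 - p vx) * (uu (w p))\<^sup>2" for p
  proof -
    have "E p = (Div \<psi> (w p) - Div \<psi> (w0 p)) / c"
      by (simp add: E_def h_def Div_def sum_subtractf flip: sum_divide_distrib)
    then show ?thesis
      using \<open>c \<noteq> 0\<close> unfolding Div w0_Jet by (simp add: w_def)
  qed
  \<comment> \<open>At the centre \<open>4x(1 - x) = 1\<close>, so the last term alone is the square
    of the test function, which is nonzero there.\<close>
  have "E (pt (1/2) (1/2) (1/2)) = 0"
  proof (rule nonneg_eq_0_if_iterated_integral_eq_0)
    show "continuous_on UNIV E"
      unfolding E_def by (intro continuous_on_sum cont)
    show "E (pt x y t) \<ge> 0" if "x \<in> {0..1}" for x y t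
      unfolding E using that by auto
    show "integral {0..1} (\<lambda>t. integral {0..1} (\<lambda>y. integral {0..1} (\<lambda>x. E (pt x y t)))) = 0"
      unfolding E_def by (rule iterated_integral_eq_0[OF cont int0])
  qed auto
  moreover have "E (pt (1/2) (1/2) (1/2)) \<ge> (uu (w (pt (1/2) (1/2) (1/2))))\<^sup>2"
    unfolding E by simp
  moreover have "uu (w (pt (1/2) (1/2) (1/2))) \<noteq> 0"
    by (auto simp: w_def g_def UNIV_var poly_power)
  ultimately show False
    by simp
qed

section \<open>Classification of the Noether symmetries\<close>

lemma noether_symmetry_classification:
  assumes S: "noether_symmetry S"
  shows "\<exists>a b c d \<beta>. solution \<beta> \<and>
    S = vadd (vscale a symT) (vadd (vscale b symR) (vadd (vscale c symX) (vadd (vscale d symY) (symW \<beta>))))"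
proof -
  obtain a b c d e \<beta> where sol: "solution \<beta>"
    and eq: "S = VField (\<lambda>i z. case i of vx \<Rightarrow> c + b * cy z | vy \<Rightarrow> d - b * cx z
      | vt \<Rightarrow> a - 2 * c * cy z + 2 * d * cx z) (\<lambda>z. e * uu z + \<beta> (base z))"
    using S by (auto simp: noether_symmetry_def elim: lie_point_symmetry_classification)
  have \<beta>: "smooth \<beta>" and sub: "sublaplacian \<beta> p = - \<beta> p" for p
    using sol by (auto simp: solution_iff add_eq_0_iff2)
  obtain \<phi> where \<phi>: "\<And>i. differential_function (\<phi> i)"
    and gauge: "\<And>z. prolong1 S lagr z + lagr z * (\<Sum>i\<in>UNIV. D i (xi S i) z) = Div \<phi> z"
    using S by (auto simp: noether_symmetry_def noether_gauge_def)
  have \<phi>_finitary: "finitary (\<phi> i)" and \<phi>_smooth: "smooth (\<phi> i)" for i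
    using \<phi>[of i] by (auto simp: differential_function_def finitary_def
        intro: smooth_partially_differentiable)
  \<comment> \<open>The isometries contribute nothing, \<open>e u \<partial>/\<partial>u\<close>
    multiplies the quadratic Lagrangian by \<open>2 * e\<close>, and the \<beta> part is the
    divergence of \<open>W_gauge\<close>.\<close>
  have Div_\<phi>: "Div \<phi> z = 2 * e * lagr z + Div (W_gauge \<beta>) z" for z
    unfolding gauge[symmetric] Div_W_gauge[OF \<beta>] sub prolong1_lagr sum_UNIV_var
    by (simp add: eq eta1_eq D_simps D_base_pd[OF \<beta>] finitary_intros finitary_base_pd[OF \<beta>] lagr_def
        algebra_simps power2_eq_square)
  \<comment> \<open>With \<open>h = 1 - 2x\<close>, \<open>2 L = (X u - h u)\<^sup>2 + (Y u)\<^sup>2 - (h' + h\<^sup>2 + 1) u\<^sup>2\<close> up to the divergence of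
    \<open>(h u\<^sup>2, 0, 2 y h u\<^sup>2)\<close>; this \<open>h\<close> makes the last coefficient nonnegative on \<open>0 \<le> x \<le> 1\<close>.\<close>
  define \<theta> :: vec where "\<theta> i z = (case i of vx \<Rightarrow> e * (1 - 2 * cx z) * (uu z)\<^sup>2 | vy \<Rightarrow> 0
    | vt \<Rightarrow> 2 * e * cy z * (1 - 2 * cx z) * (uu z)\<^sup>2)" for i z
  define \<psi> :: vec where "\<psi> i z = \<phi> i z - W_gauge \<beta> i z - \<theta> i z" for i z
  have \<theta>_finitary: "finitary (\<theta> i)" for i
    by (cases i) (simp_all add: \<theta>_def[abs_def] finitary_intros)
  have \<theta>_smooth: "smooth (\<theta> i)" for i
    by (cases i) (simp_all add: \<theta>_def[abs_def] smooth_intros)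
  have "e = 0"
  proof (rule Div_squares_trivial)
    show "differential_function (\<psi> i)" for i
      unfolding \<psi>_def[abs_def]
      by (intro differential_functionI smooth_diff finitary_diff \<phi>_smooth \<phi>_finitary
          \<theta>_smooth \<theta>_finitary W_gauge_smooth W_gauge_finitary \<beta>)
    fix z
    have "Div \<psi> z = Div \<phi> z - Div (W_gauge \<beta>) z - Div \<theta> z"
      unfolding Div_def \<psi>_def[abs_def]
      by (simp add: D_diff finitary_diff \<phi>_finitary \<theta>_finitary W_gauge_finitary \<beta> sum_subtractf)
    also have "Div \<theta> z = e * (- 2 * (uu z)\<^sup>2 + (1 - 2 * cx z) * 2 * uu z * ux z
        + 2 * cy z * (1 - 2 * cx z) * 2 * uu z * ut z)"
      unfolding Div_def sum_UNIV_var \<theta>_def[abs_def]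
      by (simp add: D_simps finitary_intros algebra_simps)
    finally show "Div \<psi> z = e * ((ux z + 2 * cy z * ut z - (1 - 2 * cx z) * uu z)\<^sup>2
      + (uy z - 2 * cx z * ut z)\<^sup>2 + 4 * cx z * (1 - cx z) * (uu z)\<^sup>2)"
      unfolding Div_\<phi> by (simp add: lagr_def algebra_simps power2_eq_square)
  qed
  have "S = vadd (vscale a symT) (vadd (vscale b symR)
      (vadd (vscale c symX) (vadd (vscale d symY) (symW \<beta>))))"
    unfolding eq vadd_def vscale_def symT_def symR_def symX_def symY_def symW_def
    by (auto simp: fun_eq_iff \<open>e = 0\<close> split: var.split)
  with sol show ?thesis
    by blast
qed

theorem theorem7:
  shows "(\<forall>S. noether_symmetry S \<longrightarrow>
            (\<exists>a b c d \<beta>. solution \<beta> \<and>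
               S = vadd (vscale a symT) (vadd (vscale b symR)
                     (vadd (vscale c symX) (vadd (vscale d symY) (symW \<beta>)))))) \<and>
         (noether_law symT tau_vec \<and> conserved tau_vec) \<and>
         (noether_law symR sigma_vec \<and> conserved sigma_vec) \<and>
         (noether_law symX chi_vec \<and> conserved chi_vec) \<and>
         (noether_law symY upsilon_vec \<and> conserved upsilon_vec) \<and>
         (\<forall>\<beta>. solution \<beta> \<longrightarrow> noether_law (symW \<beta>) (Wvec \<beta>) \<and> conserved (Wvec \<beta>))"
  using noether_symmetry_classification noether_law_tau conserved_tau noether_law_sigma
    conserved_sigma noether_law_chi conserved_chi noether_law_upsilon conserved_upsilon
    noether_law_W conserved_Wvec
  by blast

end
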